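(* Let $A$ and $B$ be left s-unital rings with $B$ left semisimple. Suppose that $f : B \to A$ is a left s-unital ring homomorphism such that $A/B$ is separable. Then $A$ is left semisimple.
   Context: Rings are associative but not necessarily unital; ring homomorphisms are additive and multiplicative maps. A left $A$-module is an additive group $M$ with a biadditive map $A\times M\to M$, $(a,m)\mapsto am$, satisfying $(aa')m=a(a'm)$. A left $A$-module $M$ is s-unital if $m\in Am$ for every $m\in M$, and firm if the map $A\otimes_A M\to M$, $a\otimes m\mapsto am$, is an isomorphism. ${}_A\mathrm{FMod}$ is the category of firm left $A$-modules and $A$-linear maps. The ring $A$ is left s-unital if it is s-unital as a left $A$-module. (Over a left s-unital ring $A$ a left module $M$ is firm iff it is s-unital iff $AM=M$.) For a ring homomorphism $f:B\to A$, $A$ is a $B$-bimodule via $b\cdot a=f(b)a$, $a\cdot b=af(b)$. $f$ is left s-unital if $A$ is s-unital as a left $B$-module. $A/B$ is separable if there is an $A$-bimodule map $\sigma:A\to A\otimes_B A$ with $\mu\circ\sigma=\mathrm{id}_A$, where $\mu:A\otimes_B A\to A$, $\mu(a\otimes a')=aa'$, and $A\otimes_B A$ (the quotient of $A\otimes_{\mathbb Z}A$ by the subgroup generated by all $af(b)\otimes a'-a\otimes f(b)a'$) has the $A$-bimodule structure $x(a\otimes a')y=xa\otimes a'y$. Let $A$ be left s-unital and $M\in{}_A\mathrm{FMod}$. A submodule of $M$ in ${}_A\mathrm{FMod}$ is an $A$-submodule of $M$ that is firm. $M$ is simple in ${}_A\mathrm{FMod}$ if it is nonzero and its only submodules in ${}_A\mathrm{FMod}$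 are $0$ and $M$. $M$ is semisimple in ${}_A\mathrm{FMod}$ if it is the direct sum of a (possibly empty) family of simple submodules in ${}_A\mathrm{FMod}$. The ring $A$ is left semisimple if $A$, as a left $A$-module, is semisimple in ${}_A\mathrm{FMod}$. *)

theory Defs
  imports "HOL-Algebra.Free_Abelian_Groups"
begin

text \<open>
  Rings are types of class \<open>ring\<close>, which is associative but does not assume a unit.
  A module over such a ring is a subset of a type of class \<open>ab_group_add\<close> together with an
  action, so that a module and its submodules are handled by the same predicates.
\<close>

definition additive_group :: "'m::ab_group_add set \<Rightarrow> 'm monoid" where
  "additive_group M = \<lparr>carrier = M, monoid.mult = (+), one = 0\<rparr>"

lemma additive_group_simps [simp]:
  "carrier (additive_group M) = M"
  "x \<otimes>\<^bsub>additive_group M\<^esub> y = x + y"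
  "\<one>\<^bsub>additive_group M\<^esub> = 0"
  by (simp_all add: additive_group_def)

lemma comm_group_additive_group:
  fixes M :: "'m::ab_group_add set"
  assumes "0 \<in> M" "\<And>x y. \<lbrakk>x \<in> M; y \<in> M\<rbrakk> \<Longrightarrow> x + y \<in> M" "\<And>x. x \<in> M \<Longrightarrow> - x \<in> M"
  shows "comm_group (additive_group M)"
  proof (rule comm_groupI)
  fix x assume "x \<in> carrier (additive_group M)"
  then show "\<exists>y\<in>carrier (additive_group M). y \<otimes>\<^bsub>additive_group M\<^esub> x = \<one>\<^bsub>additive_group M\<^esub>"
    using assms(3) by (intro bexI[of _ "- x"]) simp_all
qed (use assms in \<open>simp_all add: add_ac\<close>)

definition ring_homomorphism :: "('b::ring \<Rightarrow> 'a::ring) \<Rightarrow> bool" where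
  "ring_homomorphism f \<longleftrightarrow>
     (\<forall>x y. f (x + y) = f x + f y) \<and> (\<forall>x y. f (x * y) = f x * f y)"


section \<open>Left modules\<close>

locale left_module =
  fixes M :: "'m::ab_group_add set" and act :: "'a::ring \<Rightarrow> 'm \<Rightarrow> 'm"
  assumes zero_closed: "0 \<in> M"
    and add_closed: "\<lbrakk>m \<in> M; m' \<in> M\<rbrakk> \<Longrightarrow> m + m' \<in> M"
    and uminus_closed: "m \<in> M \<Longrightarrow> - m \<in> M"
    and act_closed: "m \<in> M \<Longrightarrow> act a m \<in> M"
    and act_add_left: "m \<in> M \<Longrightarrow> act (a + a') m = act a m + act a' m"
    and act_add_right: "\<lbrakk>m \<in> M; m' \<in> M\<rbrakk> \<Longrightarrow> act a (m + m') = act a m + act a m'"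
    and act_mult: "m \<in> M \<Longrightarrow> act (a * a') m = act a (act a' m)"

definition submodule :: "'m::ab_group_add set \<Rightarrow> 'm set \<Rightarrow> ('a::ring \<Rightarrow> 'm \<Rightarrow> 'm) \<Rightarrow> bool" where
  "submodule N M act \<longleftrightarrow> N \<subseteq> M \<and> left_module N act"

definition s_unital :: "'m::ab_group_add set \<Rightarrow> ('a::ring \<Rightarrow> 'm \<Rightarrow> 'm) \<Rightarrow> bool" where
  "s_unital M act \<longleftrightarrow> (\<forall>m\<in>M. \<exists>a. m = act a m)"


section \<open>Tensor products\<close>

text \<open>
  For a right module \<open>X\<close> with action \<open>ract\<close> and a left module \<open>Y\<close> with action \<open>lact\<close> over the
  ring \<open>'r\<close>, the tensor product is the free abelian group on \<open>X \<times> Y\<close> modulo the subgroup generated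
  by the biadditivity and balancing relations.  Its elements are cosets.
\<close>

definition tensor_relations ::
    "'x::ab_group_add set \<Rightarrow> ('x \<Rightarrow> 'r::ring \<Rightarrow> 'x) \<Rightarrow> 'y::ab_group_add set \<Rightarrow> ('r \<Rightarrow> 'y \<Rightarrow> 'y)
      \<Rightarrow> ('x \<times> 'y \<Rightarrow>\<^sub>0 int) set" where
  "tensor_relations X ract Y lact =
     {frag_of (x + x', y) - frag_of (x, y) - frag_of (x', y) | x x' y. x \<in> X \<and> x' \<in> X \<and> y \<in> Y} \<union>
     {frag_of (x, y + y') - frag_of (x, y) - frag_of (x, y') | x y y'. x \<in> X \<and> y \<in> Y \<and> y' \<in> Y} \<union>
     {frag_of (ract x r, y) - frag_of (x, lact r y) | x r y. x \<in> X \<and> y \<in> Y}"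

definition tensor_null ::
    "'x::ab_group_add set \<Rightarrow> ('x \<Rightarrow> 'r::ring \<Rightarrow> 'x) \<Rightarrow> 'y::ab_group_add set \<Rightarrow> ('r \<Rightarrow> 'y \<Rightarrow> 'y)
      \<Rightarrow> ('x \<times> 'y \<Rightarrow>\<^sub>0 int) set" where
  "tensor_null X ract Y lact =
     generate (free_Abelian_group (X \<times> Y)) (tensor_relations X ract Y lact)"

definition tensor_product ::
    "'x::ab_group_add set \<Rightarrow> ('x \<Rightarrow> 'r::ring \<Rightarrow> 'x) \<Rightarrow> 'y::ab_group_add set \<Rightarrow> ('r \<Rightarrow> 'y \<Rightarrow> 'y)
      \<Rightarrow> ('x \<times> 'y \<Rightarrow>\<^sub>0 int) set monoid" where
  "tensor_product X ract Y lact = free_Abelian_group (X \<times> Y) Mod tensor_null X ract Y lact"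

definition tensor_class ::
    "'x::ab_group_add set \<Rightarrow> ('x \<Rightarrow> 'r::ring \<Rightarrow> 'x) \<Rightarrow> 'y::ab_group_add set \<Rightarrow> ('r \<Rightarrow> 'y \<Rightarrow> 'y)
      \<Rightarrow> ('x \<times> 'y \<Rightarrow>\<^sub>0 int) \<Rightarrow> ('x \<times> 'y \<Rightarrow>\<^sub>0 int) set" where
  "tensor_class X ract Y lact c = tensor_null X ract Y lact #>\<^bsub>free_Abelian_group (X \<times> Y)\<^esub> c"

definition free_eval :: "('s \<Rightarrow> 'm::ab_group_add) \<Rightarrow> ('s \<Rightarrow>\<^sub>0 int) \<Rightarrow> 'm" where
  "free_eval \<phi> c =
     (\<Sum>s\<in>Poly_Mapping.keys c. \<phi> s [^]\<^bsub>additive_group UNIV\<^esub> Poly_Mapping.lookup c s)"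

text \<open>
  The additive maps out of a tensor product with \<open>x \<otimes> y \<mapsto> \<phi> (x, y)\<close> and, between tensor products
  of the same two modules, with \<open>x \<otimes> y \<mapsto> g x \<otimes> h y\<close>.  They are the induced maps on
  cosets, and are meaningful only if the relations are respected, in which case all representatives
  of a coset have the same image (see \<open>tensor_lift_class\<close> and \<open>tensor_map_class\<close> below).
\<close>

definition tensor_lift :: "('x \<times> 'y \<Rightarrow> 'm::ab_group_add) \<Rightarrow> ('x \<times> 'y \<Rightarrow>\<^sub>0 int) set \<Rightarrow> 'm" where
  "tensor_lift \<phi> C = the_elem (free_eval \<phi> ` C)"

definition tensor_map ::
    "'x::ab_group_add set \<Rightarrow> ('x \<Rightarrow> 'r::ring \<Rightarrow> 'x) \<Rightarrow> 'y::ab_group_add set \<Rightarrow> ('r \<Rightarrow> 'y \<Rightarrow> 'y)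
      \<Rightarrow> ('x \<Rightarrow> 'x) \<Rightarrow> ('y \<Rightarrow> 'y) \<Rightarrow> ('x \<times> 'y \<Rightarrow>\<^sub>0 int) set \<Rightarrow> ('x \<times> 'y \<Rightarrow>\<^sub>0 int) set" where
  "tensor_map X ract Y lact g h C =
     the_elem ((\<lambda>c. tensor_class X ract Y lact (frag_extend (\<lambda>(x, y). frag_of (g x, h y)) c)) ` C)"


section \<open>Firm modules, simplicity and semisimplicity\<close>

definition firm :: "'m::ab_group_add set \<Rightarrow> ('a::ring \<Rightarrow> 'm \<Rightarrow> 'm) \<Rightarrow> bool" where
  "firm M act \<longleftrightarrow>
     tensor_lift (\<lambda>(a, m). act a m)
       \<in> iso (tensor_product (UNIV :: 'a set) (*) M act) (additive_group M)"

definition FMod :: "'m::ab_group_add set \<Rightarrow> ('a::ring \<Rightarrow> 'm \<Rightarrow> 'm) \<Rightarrow> bool" where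
  "FMod M act \<longleftrightarrow> left_module M act \<and> firm M act"

definition FMod_submodule :: "'m::ab_group_add set \<Rightarrow> 'm set \<Rightarrow> ('a::ring \<Rightarrow> 'm \<Rightarrow> 'm) \<Rightarrow> bool" where
  "FMod_submodule N M act \<longleftrightarrow> submodule N M act \<and> firm N act"

definition FMod_simple :: "'m::ab_group_add set \<Rightarrow> ('a::ring \<Rightarrow> 'm \<Rightarrow> 'm) \<Rightarrow> bool" where
  "FMod_simple M act \<longleftrightarrow>
     FMod M act \<and> M \<noteq> {0} \<and> (\<forall>N. FMod_submodule N M act \<longrightarrow> N = {0} \<or> N = M)"

definition direct_sum :: "'i set \<Rightarrow> ('i \<Rightarrow> 'm::ab_group_add set) \<Rightarrow> ('i \<Rightarrow> 'm) set" where
  "direct_sum I N =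
     {c. finite {i. c i \<noteq> 0} \<and> (\<forall>i\<in>I. c i \<in> N i) \<and> (\<forall>i. i \<notin> I \<longrightarrow> c i = 0)}"

definition is_internal_direct_sum ::
    "'m::ab_group_add set \<Rightarrow> 'i set \<Rightarrow> ('i \<Rightarrow> 'm set) \<Rightarrow> bool" where
  "is_internal_direct_sum M I N \<longleftrightarrow>
     bij_betw (\<lambda>c. \<Sum>i\<in>{i. c i \<noteq> 0}. c i) (direct_sum I N) M"

text \<open>
  The family of simple submodules is indexed by itself: members of a family of nonzero submodules
  whose sum is direct are pairwise distinct.
\<close>

definition FMod_semisimple :: "'m::ab_group_add set \<Rightarrow> ('a::ring \<Rightarrow> 'm \<Rightarrow> 'm) \<Rightarrow> bool" where
  "FMod_semisimple M act \<longleftrightarrow>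
     FMod M act \<and>
     (\<exists>\<S>. (\<forall>S\<in>\<S>. FMod_submodule S M act \<and> FMod_simple S act) \<and>
          is_internal_direct_sum M \<S> (\<lambda>S. S))"


section \<open>Properties of rings and ring homomorphisms\<close>

definition left_s_unital_ring :: "'a::ring itself \<Rightarrow> bool" where
  "left_s_unital_ring _ \<longleftrightarrow> s_unital (UNIV :: 'a set) ((*) :: 'a \<Rightarrow> 'a \<Rightarrow> 'a)"

definition left_semisimple_ring :: "'a::ring itself \<Rightarrow> bool" where
  "left_semisimple_ring _ \<longleftrightarrow> FMod_semisimple (UNIV :: 'a set) ((*) :: 'a \<Rightarrow> 'a \<Rightarrow> 'a)"

definition left_s_unital_hom :: "('b::ring \<Rightarrow> 'a::ring) \<Rightarrow> bool" where
  "left_s_unital_hom f \<longleftrightarrow> s_unital (UNIV :: 'a set) (\<lambda>b a. f b * a)"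

text \<open>The tensor square of \<open>'a\<close> over \<open>'b\<close> along \<open>f\<close>, with its bimodule structure over \<open>'a\<close>.\<close>

definition tensor_square :: "('b::ring \<Rightarrow> 'a::ring) \<Rightarrow> ('a \<times> 'a \<Rightarrow>\<^sub>0 int) set monoid" where
  "tensor_square f = tensor_product UNIV (\<lambda>a b. a * f b) UNIV (\<lambda>b a. f b * a)"

definition tensor_square_left ::
    "('b::ring \<Rightarrow> 'a::ring) \<Rightarrow> 'a \<Rightarrow> ('a \<times> 'a \<Rightarrow>\<^sub>0 int) set \<Rightarrow> ('a \<times> 'a \<Rightarrow>\<^sub>0 int) set" where
  "tensor_square_left f x =
     tensor_map UNIV (\<lambda>a b. a * f b) UNIV (\<lambda>b a. f b * a) (\<lambda>a. x * a) (\<lambda>a. a)"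

definition tensor_square_right ::
    "('b::ring \<Rightarrow> 'a::ring) \<Rightarrow> ('a \<times> 'a \<Rightarrow>\<^sub>0 int) set \<Rightarrow> 'a \<Rightarrow> ('a \<times> 'a \<Rightarrow>\<^sub>0 int) set" where
  "tensor_square_right f t y =
     tensor_map UNIV (\<lambda>a b. a * f b) UNIV (\<lambda>b a. f b * a) (\<lambda>a. a) (\<lambda>a. a * y) t"

definition separable :: "('b::ring \<Rightarrow> 'a::ring) \<Rightarrow> bool" where
  "separable f \<longleftrightarrow>
     (\<exists>\<sigma>. \<sigma> \<in> hom (additive_group UNIV) (tensor_square f) \<and>
          (\<forall>x a. \<sigma> (x * a) = tensor_square_left f x (\<sigma> a)) \<and>
          (\<forall>a y. \<sigma> (a * y) = tensor_square_right f (\<sigma> a) y) \<and>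
          (\<forall>a. tensor_lift (\<lambda>(a, a'). a * a') (\<sigma> a) = a))"


section \<open>Well-definedness of the induced maps\<close>

lemma group_additive_UNIV: "group (additive_group (UNIV :: 'm::ab_group_add set))"
  by (rule comm_group.axioms(2)[OF comm_group_additive_group]) simp_all

lemma free_eval_superset:
  fixes \<phi> :: "'s \<Rightarrow> 'm::ab_group_add"
  assumes "finite K" "Poly_Mapping.keys c \<subseteq> K"
  shows "free_eval \<phi> c = (\<Sum>s\<in>K. \<phi> s [^]\<^bsub>additive_group UNIV\<^esub> Poly_Mapping.lookup c s)"
proof -
  interpret group "additive_group (UNIV :: 'm set)" by (rule group_additive_UNIV)
  have "\<phi> s [^]\<^bsub>additive_group UNIV\<^esub> (0::int) = 0" for s
    by (simp add: int_pow_def2)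
  then show ?thesis
    unfolding free_eval_def using assms
    by (intro sum.mono_neutral_left) (auto simp: in_keys_iff)
qed

lemma free_eval_frag_of [simp]:
  fixes \<phi> :: "'s \<Rightarrow> 'm::ab_group_add"
  shows "free_eval \<phi> (frag_of s) = \<phi> s"
proof -
  interpret group "additive_group (UNIV :: 'm set)" by (rule group_additive_UNIV)
  show ?thesis using int_pow_1[of "\<phi> s"] by (simp add: free_eval_def)
qed

lemma free_eval_add:
  fixes \<phi> :: "'s \<Rightarrow> 'm::ab_group_add"
  shows "free_eval \<phi> (c + d) = free_eval \<phi> c + free_eval \<phi> d"
proof -
  interpret group "additive_group (UNIV :: 'm set)" by (rule group_additive_UNIV)
  let ?K = "Poly_Mapping.keys c \<union> Poly_Mapping.keys d"
  have "\<phi> s [^]\<^bsub>additive_group UNIV\<^esub> (i + j :: int) =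
        \<phi> s [^]\<^bsub>additive_group UNIV\<^esub> i + \<phi> s [^]\<^bsub>additive_group UNIV\<^esub> j" for s i j
    using int_pow_mult[of "\<phi> s" i j] by simp
  then show ?thesis
    using free_eval_superset[of ?K c \<phi>] free_eval_superset[of ?K d \<phi>]
      free_eval_superset[of ?K "c + d" \<phi>] Poly_Mapping.keys_add[of c d]
    by (simp add: lookup_add sum.distrib)
qed

lemma free_eval_zero [simp]: "free_eval \<phi> 0 = 0"
  by (simp add: free_eval_def)

lemma free_eval_uminus: "free_eval \<phi> (- c) = - free_eval \<phi> c"
  using free_eval_add[of \<phi> c "- c"] by (simp add: eq_neg_iff_add_eq_0 add.commute)

lemma free_eval_diff: "free_eval \<phi> (c - d) = free_eval \<phi> c - free_eval \<phi> d"
  using free_eval_add[of \<phi> c "- d"] by (simp add: free_eval_uminus)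

lemma tensor_relations_carrier:
  assumes "\<And>x x'. \<lbrakk>x \<in> X; x' \<in> X\<rbrakk> \<Longrightarrow> x + x' \<in> X" "\<And>y y'. \<lbrakk>y \<in> Y; y' \<in> Y\<rbrakk> \<Longrightarrow> y + y' \<in> Y"
    and "\<And>x r. x \<in> X \<Longrightarrow> ract x r \<in> X" "\<And>r y. y \<in> Y \<Longrightarrow> lact r y \<in> Y"
  shows "tensor_relations X ract Y lact \<subseteq> carrier (free_Abelian_group (X \<times> Y))"
proof -
  have diff: "u - v \<in> carrier (free_Abelian_group S)"
    if "u \<in> carrier (free_Abelian_group S)" "v \<in> carrier (free_Abelian_group S)" for u v and S :: "'s set"
    using that Poly_Mapping.keys_diff[of u v] unfolding carrier_free_Abelian_group_iff by blast
  show ?thesis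
    unfolding tensor_relations_def
    by (intro Un_least subsetI; elim CollectE exE conjE; hypsubst;
        intro diff; unfold frag_of_in_free_Abelian_group mem_Times_iff fst_conv snd_conv)
      (use assms in auto)
qed

lemma tensor_null_subgroup:
  assumes "tensor_relations X ract Y lact \<subseteq> carrier (free_Abelian_group (X \<times> Y))"
  shows "subgroup (tensor_null X ract Y lact) (free_Abelian_group (X \<times> Y))"
  unfolding tensor_null_def
  by (rule group.generate_is_subgroup[OF group_free_Abelian_group assms])

lemma additive_on_tensor_null:
  fixes h :: "('x::ab_group_add \<times> 'y::ab_group_add \<Rightarrow>\<^sub>0 int) \<Rightarrow> 'g::ab_group_add"
  assumes rel: "tensor_relations X ract Y lact \<subseteq> carrier (free_Abelian_group (X \<times> Y))"
    and add: "\<And>c d. h (c + d) = h c + h d"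
    and zero: "\<And>c. c \<in> tensor_relations X ract Y lact \<Longrightarrow> h c = 0"
    and n: "n \<in> tensor_null X ract Y lact"
  shows "h n = 0"
proof -
  have h0: "h 0 = 0" using add[of 0 0] by simp
  have hminus: "h (- c) = - h c" for c
    using add[of c "- c"] h0 by (simp add: eq_neg_iff_add_eq_0 add.commute)
  show ?thesis
    using n unfolding tensor_null_def
  proof (induction rule: generate.induct)
    case (inv c)
    then have "Poly_Mapping.keys c \<subseteq> X \<times> Y" using subsetD[OF rel] by simp
    then show ?case using zero[OF inv] by (simp add: hminus)
  qed (use zero in \<open>auto simp: h0 add\<close>)
qed

lemma tensor_lift_class:
  assumes rel: "tensor_relations X ract Y lact \<subseteq> carrier (free_Abelian_group (X \<times> Y))"
    and "\<And>x x' y. \<lbrakk>x \<in> X; x' \<in> X; y \<in> Y\<rbrakk> \<Longrightarrow> \<phi> (x + x', y) = \<phi> (x, y) + \<phi> (x', y)"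
    and "\<And>x y y'. \<lbrakk>x \<in> X; y \<in> Y; y' \<in> Y\<rbrakk> \<Longrightarrow> \<phi> (x, y + y') = \<phi> (x, y) + \<phi> (x, y')"
    and "\<And>x r y. \<lbrakk>x \<in> X; y \<in> Y\<rbrakk> \<Longrightarrow> \<phi> (ract x r, y) = \<phi> (x, lact r y)"
  shows "tensor_lift \<phi> (tensor_class X ract Y lact c) = free_eval \<phi> c"
proof -
  have "free_eval \<phi> n = 0" if "n \<in> tensor_null X ract Y lact" for n
  proof (rule additive_on_tensor_null[OF rel _ _ that])
    show "free_eval \<phi> (c + d) = free_eval \<phi> c + free_eval \<phi> d" for c d by (rule free_eval_add)
    show "free_eval \<phi> d = 0" if "d \<in> tensor_relations X ract Y lact" for d
      using that assms(2-) unfolding tensor_relations_def by (auto simp: free_eval_diff)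
  qed
  moreover have "0 \<in> tensor_null X ract Y lact"
    using subgroup.one_closed[OF tensor_null_subgroup[OF rel]] by simp
  ultimately have "free_eval \<phi> ` tensor_class X ract Y lact c = {free_eval \<phi> c}"
    unfolding tensor_class_def r_coset_def by (force simp: free_eval_add)
  then show ?thesis by (simp add: tensor_lift_def)
qed

lemma tensor_lift_pure:
  assumes "tensor_relations X ract Y lact \<subseteq> carrier (free_Abelian_group (X \<times> Y))"
    and "\<And>x x' y. \<lbrakk>x \<in> X; x' \<in> X; y \<in> Y\<rbrakk> \<Longrightarrow> \<phi> (x + x', y) = \<phi> (x, y) + \<phi> (x', y)"
    and "\<And>x y y'. \<lbrakk>x \<in> X; y \<in> Y; y' \<in> Y\<rbrakk> \<Longrightarrow> \<phi> (x, y + y') = \<phi> (x, y) + \<phi> (x, y')"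
    and "\<And>x r y. \<lbrakk>x \<in> X; y \<in> Y\<rbrakk> \<Longrightarrow> \<phi> (ract x r, y) = \<phi> (x, lact r y)"
  shows "tensor_lift \<phi> (tensor_class X ract Y lact (frag_of (x, y))) = \<phi> (x, y)"
  using tensor_lift_class[OF assms] by simp

lemma tensor_map_class:
  assumes rel: "tensor_relations X ract Y lact \<subseteq> carrier (free_Abelian_group (X \<times> Y))"
    and g: "\<And>x. x \<in> X \<Longrightarrow> g x \<in> X" "\<And>x x'. \<lbrakk>x \<in> X; x' \<in> X\<rbrakk> \<Longrightarrow> g (x + x') = g x + g x'"
      "\<And>x r. x \<in> X \<Longrightarrow> g (ract x r) = ract (g x) r"
    and h: "\<And>y. y \<in> Y \<Longrightarrow> h y \<in> Y" "\<And>y y'. \<lbrakk>y \<in> Y; y' \<in> Y\<rbrakk> \<Longrightarrow> h (y + y') = h y + h y'"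
      "\<And>r y. y \<in> Y \<Longrightarrow> h (lact r y) = lact r (h y)"
    and c: "Poly_Mapping.keys c \<subseteq> X \<times> Y"
  shows "tensor_map X ract Y lact g h (tensor_class X ract Y lact c) =
         tensor_class X ract Y lact (frag_extend (\<lambda>(x, y). frag_of (g x, h y)) c)"
proof -
  let ?G = "free_Abelian_group (X \<times> Y)" and ?N = "tensor_null X ract Y lact"
  let ?F = "frag_extend (\<lambda>(x, y). frag_of (g x, h y))"
  interpret N: subgroup ?N ?G by (rule tensor_null_subgroup[OF rel])
  have Frel: "?F d \<in> tensor_relations X ract Y lact" if "d \<in> tensor_relations X ract Y lact" for d
    using that unfolding tensor_relations_def
  proof (elim UnE)
    assume "d \<in> {frag_of (x + x', y) - frag_of (x, y) - frag_of (x', y) | x x' y.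
      x \<in> X \<and> x' \<in> X \<and> y \<in> Y}"
    then obtain x x' y where "x \<in> X" "x' \<in> X" "y \<in> Y"
      "d = frag_of (x + x', y) - frag_of (x, y) - frag_of (x', y)" by blast
    then show "?F d \<in> {frag_of (x + x', y) - frag_of (x, y) - frag_of (x', y) | x x' y.
        x \<in> X \<and> x' \<in> X \<and> y \<in> Y} \<union>
      {frag_of (x, y + y') - frag_of (x, y) - frag_of (x, y') | x y y'. x \<in> X \<and> y \<in> Y \<and> y' \<in> Y} \<union>
      {frag_of (ract x r, y) - frag_of (x, lact r y) | x r y. x \<in> X \<and> y \<in> Y}"
      using g h
      by (intro UnI1 CollectI exI[of _ "g x"] exI[of _ "g x'"] exI[of _ "h y"])
        (simp add: frag_extend_diff)
  next
    assume "d \<in> {frag_of (x, y + y') - frag_of (x, y) - frag_of (x, y') | x y y'.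
      x \<in> X \<and> y \<in> Y \<and> y' \<in> Y}"
    then obtain x y y' where "x \<in> X" "y \<in> Y" "y' \<in> Y"
      "d = frag_of (x, y + y') - frag_of (x, y) - frag_of (x, y')" by blast
    then show "?F d \<in> {frag_of (x + x', y) - frag_of (x, y) - frag_of (x', y) | x x' y.
        x \<in> X \<and> x' \<in> X \<and> y \<in> Y} \<union>
      {frag_of (x, y + y') - frag_of (x, y) - frag_of (x, y') | x y y'. x \<in> X \<and> y \<in> Y \<and> y' \<in> Y} \<union>
      {frag_of (ract x r, y) - frag_of (x, lact r y) | x r y. x \<in> X \<and> y \<in> Y}"
      using g h
      by (intro UnI1[OF UnI2] CollectI exI[of _ "g x"] exI[of _ "h y"] exI[of _ "h y'"])
        (simp add: frag_extend_diff)
  next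
    assume "d \<in> {frag_of (ract x r, y) - frag_of (x, lact r y) | x r y. x \<in> X \<and> y \<in> Y}"
    then obtain x r y where "x \<in> X" "y \<in> Y"
      "d = frag_of (ract x r, y) - frag_of (x, lact r y)" by blast
    then show "?F d \<in> {frag_of (x + x', y) - frag_of (x, y) - frag_of (x', y) | x x' y.
        x \<in> X \<and> x' \<in> X \<and> y \<in> Y} \<union>
      {frag_of (x, y + y') - frag_of (x, y) - frag_of (x, y') | x y y'. x \<in> X \<and> y \<in> Y \<and> y' \<in> Y} \<union>
      {frag_of (ract x r, y) - frag_of (x, lact r y) | x r y. x \<in> X \<and> y \<in> Y}"
      using g h
      by (intro UnI2 CollectI exI[of _ "g x"] exI[of _ r] exI[of _ "h y"])
        (simp add: frag_extend_diff)
  qed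
  have F: "?F n \<in> ?N" if "n \<in> ?N" for n
    using that unfolding tensor_null_def
  proof (induction rule: generate.induct)
    case one
    then show ?case using generate.one[of ?G] by simp
  next
    case (incl d)
    then show ?case by (intro generate.incl Frel)
  next
    case (inv d)
    have "inv\<^bsub>?G\<^esub> d = - d" "inv\<^bsub>?G\<^esub> ?F d = - ?F d"
      using subsetD[OF rel inv] subsetD[OF rel Frel[OF inv]] by simp_all
    then show ?case using generate.inv[OF Frel[OF inv], of ?G] by (simp add: frag_extend_minus)
  next
    case (eng d e)
    then show ?case using generate.eng[of "?F d" ?G _ "?F e"] by (simp add: frag_extend_add)
  qed
  have Fc: "?F c \<in> carrier ?G"
  proof -
    have "Poly_Mapping.keys ((\<lambda>(x, y). frag_of (g x, h y)) s) \<subseteq> X \<times> Y"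
      if "s \<in> Poly_Mapping.keys c" for s
      using subsetD[OF c that] g(1) h(1) by (cases s) simp
    then show ?thesis
      using keys_frag_extend[of "\<lambda>(x, y). frag_of (g x, h y)" c]
      unfolding carrier_free_Abelian_group_iff by blast
  qed
  have "tensor_class X ract Y lact (?F (n + c)) = tensor_class X ract Y lact (?F c)"
    if "n \<in> ?N" for n
  proof -
    have "?N #>\<^bsub>?G\<^esub> (?F n \<otimes>\<^bsub>?G\<^esub> ?F c) = ?N #>\<^bsub>?G\<^esub> ?F n #>\<^bsub>?G\<^esub> ?F c"
      using group.coset_mult_assoc[OF group_free_Abelian_group N.subset N.mem_carrier[OF F[OF that]] Fc]
      by simp
    also have "?N #>\<^bsub>?G\<^esub> ?F n = ?N"
      by (rule N.rcos_const[OF group_free_Abelian_group F[OF that]])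
    finally show ?thesis by (simp add: tensor_class_def frag_extend_add)
  qed
  moreover have "0 \<in> ?N" using N.one_closed by simp
  ultimately have "(\<lambda>c. tensor_class X ract Y lact (?F c)) ` tensor_class X ract Y lact c
      = {tensor_class X ract Y lact (?F c)}"
    unfolding tensor_class_def[of X ract Y lact c] r_coset_def by force
  then show ?thesis by (simp add: tensor_map_def)
qed

lemma tensor_square_left_pure:
  fixes f :: "'b::ring \<Rightarrow> 'a::ring"
  shows "tensor_square_left f x
           (tensor_class UNIV (\<lambda>a b. a * f b) UNIV (\<lambda>b a. f b * a) (frag_of (a, a'))) =
         tensor_class UNIV (\<lambda>a b. a * f b) UNIV (\<lambda>b a. f b * a) (frag_of (x * a, a'))"
  unfolding tensor_square_left_def
  by (subst tensor_map_class) (auto simp: algebra_simps)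

lemma tensor_square_right_pure:
  fixes f :: "'b::ring \<Rightarrow> 'a::ring"
  shows "tensor_square_right f
           (tensor_class UNIV (\<lambda>a b. a * f b) UNIV (\<lambda>b a. f b * a) (frag_of (a, a'))) y =
         tensor_class UNIV (\<lambda>a b. a * f b) UNIV (\<lambda>b a. f b * a) (frag_of (a, a' * y))"
  unfolding tensor_square_right_def
  by (subst tensor_map_class) (auto simp: algebra_simps)

end

theory Submission
  imports Defs "HOL-Library.Set_Algebras"
begin

text \<open>
  The proof is Maschke's averaging argument, carried out with local units in place of a unit.

  Over a left s-unital ring, firm modules are exactly the s-unital ones (\<open>FMod_iff_s_unital\<close>).
  Being s-unital is a condition on single elements, so it passes to all submodules; the firm
  submodules of a firm module are therefore all of its submodules, and simplicity and
  semisimplicity in the category of firm modules become statements about ordinary submodules.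

  Let \<open>M\<close> be an s-unital \<open>A\<close>-module. Since \<open>f\<close> is left s-unital, \<open>M\<close> is s-unital over \<open>B\<close>, and since
  \<open>B\<close> is a sum of minimal left ideals, every \<open>B\<close>-submodule of \<open>M\<close> is a direct summand
  (\<open>completely_reducible_over_semisimple_ring\<close>). Hence each \<open>A\<close>-submodule \<open>N\<close> is the image of a \<open>B\<close>-linear
  retraction \<open>\<pi> : M \<rightarrow> N\<close>. For \<open>m \<in> M\<close> the expression \<open>x \<pi>(y m)\<close> is additive in \<open>x\<close> and \<open>y\<close> and
  \<open>B\<close>-balanced, so it defines an additive map \<open>\<phi>\<^sub>m\<close> on \<open>A \<otimes>\<^sub>B A\<close>. If \<open>\<sigma>\<close> is a bimodule section of the
  multiplication and \<open>e m = m\<close>, put \<open>\<rho>(m) = \<phi>\<^sub>m(\<sigma>(e))\<close>. For unital \<open>A\<close> one takes \<open>e = 1\<close> and \<open>\<sigma>(1)\<close> is the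
  separability idempotent; here any two choices of \<open>e\<close> are compared through a common left unit of
  both. The map \<open>\<rho>\<close> is an \<open>A\<close>-linear retraction onto \<open>N\<close> (\<open>retraction_of_separable\<close>), and its kernel is a
  complement of \<open>N\<close>.

  So every \<open>A\<close>-submodule of \<open>M\<close> is a direct summand, which forces \<open>M\<close> to be a direct sum of simple
  submodules (\<open>direct_sum_of_simples\<close>). The theorem is the case in which \<open>M\<close> is \<open>A\<close> itself.
\<close>

section \<open>Modules, submodules and sums of submodules\<close>

context left_module
begin

lemma act_zero_right: "act a 0 = 0"
  using act_add_right[OF zero_closed zero_closed, of a] by simp

lemma act_zero_left: "m \<in> M \<Longrightarrow> act 0 m = 0"
  using act_add_left[of m 0 0] by simp

lemma act_uminus_right: "m \<in> M \<Longrightarrow> act a (- m) = - act a m"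
  using act_add_right[of m "- m" a] uminus_closed[of m] act_zero_right[of a]
  by (simp add: eq_neg_iff_add_eq_0 add.commute)

lemma act_uminus_left: "m \<in> M \<Longrightarrow> act (- a) m = - act a m"
  using act_add_left[of m a "- a"] act_zero_left[of m]
  by (simp add: eq_neg_iff_add_eq_0 add.commute)

lemma diff_closed: "m \<in> M \<Longrightarrow> m' \<in> M \<Longrightarrow> m - m' \<in> M"
  using add_closed[of m "- m'"] uminus_closed[of m'] by simp

lemma act_diff_right: "m \<in> M \<Longrightarrow> m' \<in> M \<Longrightarrow> act a (m - m') = act a m - act a m'"
  using act_add_right[of m "- m'" a] uminus_closed[of m'] act_uminus_right[of m' a] by simp

lemma act_diff_left: "m \<in> M \<Longrightarrow> act (a - a') m = act a m - act a' m"
  using act_add_left[of m a "- a'"] act_uminus_left[of m a'] by simp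

lemma sum_closed: "(\<And>i. i \<in> I \<Longrightarrow> g i \<in> M) \<Longrightarrow> sum g I \<in> M"
  by (induction I rule: infinite_finite_induct) (auto simp: zero_closed add_closed)

lemma act_sum_left: "m \<in> M \<Longrightarrow> act (sum g I) m = (\<Sum>i\<in>I. act (g i) m)"
  by (induction I rule: infinite_finite_induct) (auto simp: act_zero_left act_add_left)

lemma act_sum_right: "(\<And>i. i \<in> I \<Longrightarrow> g i \<in> M) \<Longrightarrow> act a (sum g I) = (\<Sum>i\<in>I. act a (g i))"
  by (induction I rule: infinite_finite_induct) (auto simp: act_zero_right act_add_right sum_closed)

lemma submoduleI:
  assumes "N \<subseteq> M" "0 \<in> N" "\<And>x y. \<lbrakk>x \<in> N; y \<in> N\<rbrakk> \<Longrightarrow> x + y \<in> N"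
    and "\<And>x. x \<in> N \<Longrightarrow> - x \<in> N" "\<And>a x. x \<in> N \<Longrightarrow> act a x \<in> N"
  shows "submodule N M act"
  unfolding submodule_def
  using assms act_add_left act_add_right act_mult by (auto simp: left_module_def subset_iff)

lemma submodule_zero: "submodule {0} M act"
  by (rule submoduleI) (auto simp: zero_closed act_zero_right)

lemma submodule_image_act:
  assumes S: "left_module S (*)" and m: "m \<in> M"
  shows "submodule ((\<lambda>s. act s m) ` S) M act"
proof -
  interpret S: left_module S "(*)" by (rule S)
  show ?thesis
  proof (rule submoduleI)
    show "(\<lambda>s. act s m) ` S \<subseteq> M" using m act_closed by blast
    show "0 \<in> (\<lambda>s. act s m) ` S" using act_zero_left[OF m] S.zero_closed by force
  qed (auto simp: act_add_left[OF m, symmetric] act_uminus_left[OF m, symmetric]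
      act_mult[OF m, symmetric] S.add_closed S.uminus_closed S.act_closed)
qed

lemma submodule_set_plus:
  assumes "submodule N M act" "submodule K M act"
  shows "submodule (N + K) M act"
proof -
  interpret N: left_module N act using assms(1) by (simp add: submodule_def)
  interpret K: left_module K act using assms(2) by (simp add: submodule_def)
  have sub: "N \<subseteq> M" "K \<subseteq> M" using assms by (auto simp: submodule_def)
  show ?thesis
  proof (rule submoduleI)
    show "N + K \<subseteq> M" using sub add_closed by (auto elim!: set_plus_elim)
    show "0 \<in> N + K" using set_plus_intro[OF N.zero_closed K.zero_closed] by simp
  next
    fix x y assume "x \<in> N + K" "y \<in> N + K"
    then obtain n k n' k' where "n \<in> N" "k \<in> K" "n' \<in> N" "k' \<in> K" "x = n + k" "y = n' + k'"
      by (auto elim!: set_plus_elim)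
    then show "x + y \<in> N + K"
      using set_plus_intro[OF N.add_closed[of n n'] K.add_closed[of k k']] by (simp add: add_ac)
  next
    fix x assume "x \<in> N + K"
    then obtain n k where "n \<in> N" "k \<in> K" "x = n + k" by (auto elim!: set_plus_elim)
    then show "- x \<in> N + K"
      using set_plus_intro[OF N.uminus_closed[of n] K.uminus_closed[of k]] by simp
  next
    fix a x assume "x \<in> N + K"
    then obtain n k where nk: "n \<in> N" "k \<in> K" "x = n + k" by (auto elim!: set_plus_elim)
    moreover have "act a x = act a n + act a k" using nk sub act_add_right by blast
    ultimately show "act a x \<in> N + K"
      using set_plus_intro[OF N.act_closed[of n a] K.act_closed[of k a]] by simp
  qed
qed

lemma submodule_Union_chain:
  assumes "\<C> \<noteq> {}" "\<And>N. N \<in> \<C> \<Longrightarrow> submodule N M act"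
    and chain: "\<And>N K. \<lbrakk>N \<in> \<C>; K \<in> \<C>\<rbrakk> \<Longrightarrow> N \<subseteq> K \<or> K \<subseteq> N"
  shows "submodule (\<Union>\<C>) M act"
proof (rule submoduleI)
  have mod: "left_module N act" if "N \<in> \<C>" for N
    using assms(2)[OF that] by (simp add: submodule_def)
  show "\<Union>\<C> \<subseteq> M" using assms(2) by (auto simp: submodule_def)
  show "0 \<in> \<Union>\<C>" using assms(1) mod left_module.zero_closed by blast
  show "x + y \<in> \<Union>\<C>" if xy: "x \<in> \<Union>\<C>" "y \<in> \<Union>\<C>" for x y
  proof -
    obtain N K where "N \<in> \<C>" "K \<in> \<C>" "x \<in> N" "y \<in> K" using xy by blast
    then obtain L where "L \<in> \<C>" "x \<in> L" "y \<in> L" using chain[of N K] by blast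
    then show ?thesis using mod left_module.add_closed by blast
  qed
  show "- x \<in> \<Union>\<C>" if "x \<in> \<Union>\<C>" for x
    using that mod left_module.uminus_closed by blast
  show "act a x \<in> \<Union>\<C>" if "x \<in> \<Union>\<C>" for a x
    using that mod left_module.act_closed by blast
qed

lemma maximal_submodule_exists:
  assumes N\<^sub>0: "submodule N\<^sub>0 M act" "P N\<^sub>0"
    and P: "\<And>\<C>. \<lbrakk>\<C> \<noteq> {}; \<forall>N\<in>\<C>. P N\<rbrakk> \<Longrightarrow> P (\<Union>\<C>)"
  obtains K where "submodule K M act" "P K"
    "\<And>X. \<lbrakk>submodule X M act; P X; K \<subseteq> X\<rbrakk> \<Longrightarrow> X = K"
proof -
  let ?\<A> = "{K. submodule K M act \<and> P K}"
  have "\<exists>K\<in>?\<A>. \<forall>X\<in>?\<A>. K \<subseteq> X \<longrightarrow> X = K"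
  proof (rule subset_Zorn_nonempty)
    show "?\<A> \<noteq> {}" using N\<^sub>0 by blast
    fix \<C> assume \<C>: "\<C> \<noteq> {}" "subset.chain ?\<A> \<C>"
    then have sub: "\<C> \<subseteq> ?\<A>" and chain: "\<And>N K. \<lbrakk>N \<in> \<C>; K \<in> \<C>\<rbrakk> \<Longrightarrow> N \<subseteq> K \<or> K \<subseteq> N"
      by (simp_all add: subset_chain_def)
    have "submodule (\<Union>\<C>) M act"
      by (rule submodule_Union_chain[OF \<C>(1) _ chain]) (use sub in blast)
    moreover have "P (\<Union>\<C>)" using P[OF \<C>(1)] sub by blast
    ultimately show "\<Union>\<C> \<in> ?\<A>" by simp
  qed
  then obtain K where K: "submodule K M act" "P K"
    and Kmax: "\<forall>X\<in>?\<A>. K \<subseteq> X \<longrightarrow> X = K" by (elim bexE CollectE conjE)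
  show ?thesis by (rule that[OF K]) (use Kmax in simp)
qed

end

lemma submodule_trans: "\<lbrakk>submodule K N act; submodule N M act\<rbrakk> \<Longrightarrow> submodule K M act"
  by (auto simp: submodule_def)

lemma submodule_Int:
  assumes "submodule N M act" "submodule K M act"
  shows "submodule (N \<inter> K) N act"
  using assms by (auto simp: submodule_def left_module_def)

lemma s_unital_subset: "\<lbrakk>s_unital M act; N \<subseteq> M\<rbrakk> \<Longrightarrow> s_unital N act"
  by (auto simp: s_unital_def)


section \<open>Common local units and firmness\<close>

text \<open>
  If \<open>e\<close> fixes finitely many elements and \<open>u\<close> fixes the defect \<open>x - e x\<close> of a further element \<open>x\<close>,
  then \<open>e + u - u e\<close> fixes all of them: in a unital ring this is \<open>1 - (1 - u) (1 - e)\<close>.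
\<close>

lemma (in left_module) common_local_unit:
  assumes "s_unital M act" "finite X" "X \<subseteq> M"
  shows "\<exists>e. \<forall>m\<in>X. act e m = m"
  using assms(2,3)
proof (induction X rule: finite_induct)
  case (insert x X)
  then obtain e where e: "\<forall>m\<in>X. act e m = m" and x: "x \<in> M" and X: "X \<subseteq> M" by auto
  have "x - act e x \<in> M" using x by (simp add: diff_closed act_closed)
  then obtain u where u: "x - act e x = act u (x - act e x)"
    using assms(1) unfolding s_unital_def by blast
  define d where "d = e + u - u * e"
  have d: "act d m = act e m + act u (m - act e m)" if "m \<in> M" for m
    using that by (simp add: d_def act_diff_left act_add_left act_mult act_diff_right act_closed)
  have "act d x = x" using d[OF x] u by (metis add.commute diff_add_cancel)
  moreover have "act d m = m" if "m \<in> X" for m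
    using d[of m] that e X by (auto simp: act_zero_right)
  ultimately show ?case by blast
qed simp

lemma left_module_ring: "left_module (UNIV :: 'a::ring set) (*)"
  by unfold_locales (auto simp: algebra_simps)

lemma common_left_unit:
  assumes "left_s_unital_ring TYPE('a::ring)" "finite X"
  shows "\<exists>e. \<forall>a\<in>X. e * a = (a::'a)"
  using left_module.common_local_unit[OF left_module_ring, of X] assms
  by (simp add: left_s_unital_ring_def)

context left_module
begin

lemma action_relations_carrier:
  "tensor_relations (UNIV :: 'a set) (*) M act \<subseteq> carrier (free_Abelian_group (UNIV \<times> M))"
  by (rule tensor_relations_carrier) (auto simp: add_closed act_closed)

lemma action_lift_class:
  "tensor_lift (\<lambda>(a, m). act a m) (tensor_class (UNIV :: 'a set) (*) M act c)
     = free_eval (\<lambda>(a, m). act a m) c"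
  by (rule tensor_lift_class[OF action_relations_carrier])
    (auto simp: act_add_left act_add_right act_mult)

lemma free_eval_closed:
  assumes "\<And>s. s \<in> Poly_Mapping.keys c \<Longrightarrow> \<phi> s \<in> M"
  shows "free_eval \<phi> c \<in> M"
  by (rule frag_induction[of c "{s. \<phi> s \<in> M}"])
    (use assms in \<open>auto simp: zero_closed free_eval_diff diff_closed\<close>)

text \<open>
  With a common left unit \<open>e\<close> of all the \<open>a\<^sub>i\<close>, the element \<open>\<Sum> a\<^sub>i \<otimes> m\<^sub>i = \<Sum> e a\<^sub>i \<otimes> m\<^sub>i\<close> equals
  \<open>e \<otimes> \<Sum> a\<^sub>i m\<^sub>i\<close>, so it is determined by its image under \<open>a \<otimes> m \<mapsto> a m\<close>. This is why that map is
  injective.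
\<close>

lemma collapse_modulo_tensor_null:
  assumes "Poly_Mapping.keys c \<subseteq> {(a, m). e * a = a \<and> m \<in> M}"
  shows "c - frag_of (e, free_eval (\<lambda>(a, m). act a m) c) \<in> tensor_null (UNIV :: 'a set) (*) M act"
proof -
  let ?R = "tensor_relations (UNIV :: 'a set) (*) M act" and ?N = "tensor_null (UNIV :: 'a set) (*) M act"
  let ?ev = "free_eval (\<lambda>(a, m). act a m)"
  interpret N: subgroup ?N "free_Abelian_group (UNIV \<times> M)"
    by (rule tensor_null_subgroup[OF action_relations_carrier])
  have add: "u + v \<in> ?N" if "u \<in> ?N" "v \<in> ?N" for u v using N.m_closed[OF that] by simp
  have minus: "- u \<in> ?N" if "u \<in> ?N" for u
    using N.m_inv_closed[OF that] N.mem_carrier[OF that] by simp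
  have incl: "r \<in> ?N" if "r \<in> ?R" for r
    using that unfolding tensor_null_def by (rule generate.incl)
  have add_rel: "frag_of (e, m + m') - frag_of (e, m) - frag_of (e, m') \<in> ?N"
    if "m \<in> M" "m' \<in> M" for m m'
    by (rule incl) (use that in \<open>unfold tensor_relations_def, blast\<close>)
  \<comment> \<open>Membership of the value in \<open>M\<close> is carried along since the relations only concern elements of \<open>M\<close>.\<close>
  have "?ev c \<in> M \<and> c - frag_of (e, ?ev c) \<in> ?N"
    using assms
  proof (rule frag_induction)
    show "?ev 0 \<in> M \<and> 0 - frag_of (e, ?ev 0) \<in> ?N"
      using add_rel[OF zero_closed zero_closed] by (simp add: zero_closed)
  next
    fix s assume "s \<in> {(a, m). e * a = a \<and> m \<in> M}"
    then obtain a m where s: "s = (a, m)" "e * a = a" "m \<in> M" by blast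
    have "frag_of (e * a, m) - frag_of (e, act a m) \<in> ?R"
      unfolding tensor_relations_def using s(3) by blast
    then show "?ev (frag_of s) \<in> M \<and> frag_of s - frag_of (e, ?ev (frag_of s)) \<in> ?N"
      using incl s by (simp add: act_closed)
  next
    fix u v
    assume u: "?ev u \<in> M \<and> u - frag_of (e, ?ev u) \<in> ?N"
      and v: "?ev v \<in> M \<and> v - frag_of (e, ?ev v) \<in> ?N"
    have d: "?ev u - ?ev v \<in> M" using u v diff_closed by blast
    \<comment> \<open>The last summand is the additivity relation that replaces \<open>e \<otimes> (p - q)\<close> by \<open>e \<otimes> p - e \<otimes> q\<close>.\<close>
    have "(u - frag_of (e, ?ev u)) + - (v - frag_of (e, ?ev v))
        + (frag_of (e, (?ev u - ?ev v) + ?ev v) - frag_of (e, ?ev u - ?ev v) - frag_of (e, ?ev v)) \<in> ?N"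
      using u v add_rel[OF d, of "?ev v"] by (intro add minus) auto
    then show "?ev (u - v) \<in> M \<and> u - v - frag_of (e, ?ev (u - v)) \<in> ?N"
      using d by (simp add: free_eval_diff)
  qed
  then show ?thesis by blast
qed

end

lemma carrier_tensor_product:
  "carrier (tensor_product X ract Y lact)
     = tensor_class X ract Y lact ` carrier (free_Abelian_group (X \<times> Y))"
  by (auto simp: tensor_product_def FactGroup_def RCOSETS_def tensor_class_def)

lemma (in left_module) s_unital_imp_firm:
  assumes "left_s_unital_ring TYPE('a)" "s_unital M act"
  shows "firm M act"
proof -
  let ?G = "free_Abelian_group ((UNIV :: 'a set) \<times> M)" and ?N = "tensor_null (UNIV :: 'a set) (*) M act"
  let ?T = "tensor_product (UNIV :: 'a set) (*) M act" and ?cl = "tensor_class (UNIV :: 'a set) (*) M act"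
  let ?L = "tensor_lift (\<lambda>(a, m). act a m)" and ?ev = "free_eval (\<lambda>(a, m). act a m)"
  interpret N: subgroup ?N ?G by (rule tensor_null_subgroup[OF action_relations_carrier])
  interpret G: comm_group ?G by (rule abelian_free_Abelian_group)
  interpret N: normal ?N ?G by (rule G.subgroup_imp_normal) (rule N.subgroup_axioms)
  have ev_closed: "?ev c \<in> M" if "c \<in> carrier ?G" for c
    using that by (intro free_eval_closed) (auto simp: act_closed)
  have mult: "?cl c \<otimes>\<^bsub>?T\<^esub> ?cl d = ?cl (c + d)" if "c \<in> carrier ?G" "d \<in> carrier ?G" for c d
    using N.rcos_sum[OF that] by (simp add: tensor_product_def tensor_class_def FactGroup_def)
  have inj: "?cl c = ?cl d" if c: "c \<in> carrier ?G" and d: "d \<in> carrier ?G" and eq: "?ev c = ?ev d" for c d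
  proof -
    obtain e where e: "\<And>s. s \<in> Poly_Mapping.keys c \<union> Poly_Mapping.keys d \<Longrightarrow> e * fst s = fst s"
      using common_left_unit[OF assms(1), of "fst ` (Poly_Mapping.keys c \<union> Poly_Mapping.keys d)"] by auto
    have "c - frag_of (e, ?ev c) \<in> ?N" "d - frag_of (e, ?ev d) \<in> ?N"
      using c d e by (intro collapse_modulo_tensor_null; fastforce)+
    then have "(c - frag_of (e, ?ev c)) \<otimes>\<^bsub>?G\<^esub> inv\<^bsub>?G\<^esub> (d - frag_of (e, ?ev d)) \<in> ?N"
      by (intro N.m_closed N.m_inv_closed)
    then have "c - d \<in> ?N"
      using N.mem_carrier[OF \<open>d - frag_of (e, ?ev d) \<in> ?N\<close>] by (simp add: eq)
    then have "c \<in> ?cl d"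
      unfolding tensor_class_def r_coset_def by (auto intro!: bexI[of _ "c - d"])
    then show ?thesis
      unfolding tensor_class_def using G.repr_independence[OF _ d N.subgroup_axioms] by metis
  qed
  show ?thesis unfolding firm_def
  proof (rule isoI)
    show "?L \<in> hom ?T (additive_group M)"
    proof (rule homI)
      fix x assume "x \<in> carrier ?T"
      then show "?L x \<in> carrier (additive_group M)"
        by (auto simp: carrier_tensor_product action_lift_class ev_closed simp del: carrier_free_Abelian_group_iff)
    next
      fix x y assume "x \<in> carrier ?T" "y \<in> carrier ?T"
      then obtain c d where "c \<in> carrier ?G" "d \<in> carrier ?G" "x = ?cl c" "y = ?cl d"
        by (auto simp: carrier_tensor_product simp del: carrier_free_Abelian_group_iff)
      then show "?L (x \<otimes>\<^bsub>?T\<^esub> y) = ?L x \<otimes>\<^bsub>additive_group M\<^esub> ?L y"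
        by (simp add: mult action_lift_class free_eval_add del: carrier_free_Abelian_group_iff)
    qed
    show "bij_betw ?L (carrier ?T) (carrier (additive_group M))"
      unfolding bij_betw_def
    proof
      show "inj_on ?L (carrier ?T)"
      proof (rule inj_onI)
        fix x y assume xy: "x \<in> carrier ?T" "y \<in> carrier ?T" "?L x = ?L y"
        then obtain c d where cd: "c \<in> carrier ?G" "d \<in> carrier ?G" "x = ?cl c" "y = ?cl d"
          by (auto simp: carrier_tensor_product simp del: carrier_free_Abelian_group_iff)
        then show "x = y" using xy(3) inj[OF cd(1,2)] by (simp only: action_lift_class)
      qed
      show "?L ` carrier ?T = carrier (additive_group M)"
      proof
        show "?L ` carrier ?T \<subseteq> carrier (additive_group M)"
          by (auto simp: carrier_tensor_product action_lift_class ev_closed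
              simp del: carrier_free_Abelian_group_iff)
        show "carrier (additive_group M) \<subseteq> ?L ` carrier ?T"
        proof
          fix m assume "m \<in> carrier (additive_group M)"
          then have m: "m \<in> M" by simp
          then obtain a where a: "m = act a m" using assms(2) by (auto simp: s_unital_def)
          have "?cl (frag_of (a, m)) \<in> carrier ?T" using m by (simp add: carrier_tensor_product)
          moreover have "?L (?cl (frag_of (a, m))) = m" using a by (simp add: action_lift_class)
          ultimately show "m \<in> ?L ` carrier ?T" by (metis image_eqI)
        qed
      qed
    qed
  qed
qed

text \<open>
  By surjectivity each \<open>m\<close> is a finite sum \<open>\<Sum> a\<^sub>i m\<^sub>i\<close>, and a common left unit of the \<open>a\<^sub>i\<close> fixes it.
\<close>

lemma (in left_module) firm_imp_s_unital:
  assumes "left_s_unital_ring TYPE('a)" "firm M act"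
  shows "s_unital M act"
  unfolding s_unital_def
proof
  let ?ev = "free_eval (\<lambda>(a, m). act a m)"
  fix m assume "m \<in> M"
  then have "m \<in> tensor_lift (\<lambda>(a, m). act a m) ` carrier (tensor_product (UNIV :: 'a set) (*) M act)"
    using assms(2) by (simp add: firm_def iso_def bij_betw_def)
  then obtain c where c: "Poly_Mapping.keys c \<subseteq> UNIV \<times> M" and m: "m = ?ev c"
    by (auto simp: carrier_tensor_product action_lift_class)
  obtain e where e: "\<And>s. s \<in> Poly_Mapping.keys c \<Longrightarrow> e * fst s = fst s"
    using common_left_unit[OF assms(1), of "fst ` Poly_Mapping.keys c"] by auto
  have "Poly_Mapping.keys c \<subseteq> {(a, m). e * a = a \<and> m \<in> M}" using c e by fastforce
  then have "?ev c \<in> M \<and> act e (?ev c) = ?ev c"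
  proof (rule frag_induction)
    show "?ev (frag_of s) \<in> M \<and> act e (?ev (frag_of s)) = ?ev (frag_of s)"
      if s: "s \<in> {(a, m). e * a = a \<and> m \<in> M}" for s
    proof -
      obtain a m where "s = (a, m)" "e * a = a" "m \<in> M" using s by blast
      then show ?thesis using act_mult[of m e a] by (simp add: act_closed)
    qed
  qed (auto simp: free_eval_diff zero_closed act_zero_right diff_closed act_diff_right)
  then show "\<exists>a. m = act a m" using m by metis
qed

lemma FMod_iff_s_unital:
  fixes act :: "'a::ring \<Rightarrow> 'm::ab_group_add \<Rightarrow> 'm"
  assumes "left_s_unital_ring TYPE('a)"
  shows "FMod M act \<longleftrightarrow> left_module M act \<and> s_unital M act"
  using assms left_module.s_unital_imp_firm left_module.firm_imp_s_unital
  unfolding FMod_def by blast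

lemma FMod_submodule_iff_submodule:
  fixes act :: "'a::ring \<Rightarrow> 'm::ab_group_add \<Rightarrow> 'm"
  assumes "left_s_unital_ring TYPE('a)" "s_unital M act"
  shows "FMod_submodule N M act \<longleftrightarrow> submodule N M act"
  using left_module.s_unital_imp_firm[OF _ assms(1) s_unital_subset[OF assms(2)]]
  by (auto simp: FMod_submodule_def submodule_def)

definition simple_module :: "'m::ab_group_add set \<Rightarrow> ('a::ring \<Rightarrow> 'm \<Rightarrow> 'm) \<Rightarrow> bool" where
  "simple_module S act \<longleftrightarrow>
     left_module S act \<and> S \<noteq> {0} \<and> (\<forall>N. submodule N S act \<longrightarrow> N = {0} \<or> N = S)"

lemma FMod_simple_iff_simple_module:
  fixes act :: "'a::ring \<Rightarrow> 'm::ab_group_add \<Rightarrow> 'm"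
  assumes "left_s_unital_ring TYPE('a)" "s_unital S act"
  shows "FMod_simple S act \<longleftrightarrow> simple_module S act"
  using assms FMod_submodule_iff_submodule[OF assms]
  by (simp add: FMod_simple_def simple_module_def FMod_iff_s_unital[OF assms(1)])


section \<open>Complete reducibility and retractions\<close>

definition completely_reducible :: "'m::ab_group_add set \<Rightarrow> ('a::ring \<Rightarrow> 'm \<Rightarrow> 'm) \<Rightarrow> bool" where
  "completely_reducible M act \<longleftrightarrow>
     (\<forall>N. submodule N M act \<longrightarrow> (\<exists>K. submodule K M act \<and> N \<inter> K = {0} \<and> N + K = M))"

text \<open>
  This is the modular law: if \<open>K\<close> is a complement of \<open>N\<close> in \<open>M\<close> and \<open>N \<subseteq> L\<close>, then \<open>L \<inter> K\<close> is a
  complement of \<open>N\<close> in \<open>L\<close>.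
\<close>

lemma completely_reducible_submodule:
  assumes cr: "completely_reducible M act" and L: "submodule L M act"
  shows "completely_reducible L act"
  unfolding completely_reducible_def
proof (intro allI impI)
  fix N assume N: "submodule N L act"
  interpret L: left_module L act using L by (simp add: submodule_def)
  obtain K where K: "submodule K M act" "N \<inter> K = {0}" "N + K = M"
    using cr submodule_trans[OF N L] unfolding completely_reducible_def by blast
  have "L \<subseteq> N + (L \<inter> K)"
  proof
    fix x assume x: "x \<in> L"
    then have "x \<in> N + K" using K(3) L by (auto simp: submodule_def)
    then obtain n k where nk: "n \<in> N" "k \<in> K" "x = n + k" by (auto elim!: set_plus_elim)
    moreover have "k \<in> L" using L.diff_closed[OF x, of n] nk N by (auto simp: submodule_def)
    ultimately show "x \<in> N + (L \<inter> K)" by auto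
  qed
  moreover have "N + (L \<inter> K) \<subseteq> L"
    using L.submodule_set_plus[OF N submodule_Int[OF L K(1)]] by (simp add: submodule_def)
  moreover have "N \<inter> (L \<inter> K) = {0}" using K(2) N by (auto simp: submodule_def)
  ultimately show "\<exists>K. submodule K L act \<and> N \<inter> K = {0} \<and> N + K = L"
    using submodule_Int[OF L K(1)] by blast
qed

definition module_retraction ::
    "'m::ab_group_add set \<Rightarrow> 'm set \<Rightarrow> ('a::ring \<Rightarrow> 'm \<Rightarrow> 'm) \<Rightarrow> ('m \<Rightarrow> 'm) \<Rightarrow> bool" where
  "module_retraction M N act \<pi> \<longleftrightarrow>
     (\<forall>m\<in>M. \<pi> m \<in> N) \<and> (\<forall>m\<in>M. \<forall>m'\<in>M. \<pi> (m + m') = \<pi> m + \<pi> m') \<and>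
     (\<forall>a. \<forall>m\<in>M. \<pi> (act a m) = act a (\<pi> m)) \<and> (\<forall>n\<in>N. \<pi> n = n)"

lemma (in left_module) retraction_of_complement:
  assumes N: "submodule N M act" and K: "submodule K M act" and NK: "N \<inter> K = {0}" "N + K = M"
  shows "\<exists>\<pi>. module_retraction M N act \<pi>"
proof -
  interpret N: left_module N act using N by (simp add: submodule_def)
  interpret K: left_module K act using K by (simp add: submodule_def)
  have sub: "N \<subseteq> M" "K \<subseteq> M" using N K by (auto simp: submodule_def)
  define \<pi> where "\<pi> m = (THE n. n \<in> N \<and> m - n \<in> K)" for m
  have \<pi>I: "\<pi> (n + k) = n" if nk: "n \<in> N" "k \<in> K" for n k
    unfolding \<pi>_def
  proof (rule the_equality)
    show "n \<in> N \<and> n + k - n \<in> K" using nk by simp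
    fix n' assume n': "n' \<in> N \<and> n + k - n' \<in> K"
    then have "n + k - n' - k \<in> K" using K.diff_closed nk by blast
    moreover have "n + k - n' - k = n - n'" by simp
    moreover have "n - n' \<in> N" using N.diff_closed nk n' by blast
    ultimately have "n - n' \<in> N \<inter> K" by simp
    then show "n' = n" unfolding NK(1) by simp
  qed
  have dec: "\<exists>n\<in>N. \<exists>k\<in>K. m = n + k" if "m \<in> M" for m
    using that NK(2) by (auto elim!: set_plus_elim)
  have "module_retraction M N act \<pi>"
    unfolding module_retraction_def
  proof (intro conjI ballI allI)
    show "\<pi> m \<in> N" if "m \<in> M" for m using dec[OF that] \<pi>I by auto
    show "\<pi> n = n" if "n \<in> N" for n using \<pi>I[OF that K.zero_closed] by simp
    show "\<pi> (m + m') = \<pi> m + \<pi> m'" if m: "m \<in> M" "m' \<in> M" for m m'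
    proof -
      obtain n k n' k' where "n \<in> N" "k \<in> K" "m = n + k" "n' \<in> N" "k' \<in> K" "m' = n' + k'"
        using dec[OF m(1)] dec[OF m(2)] by blast
      then show ?thesis
        using \<pi>I[OF N.add_closed[of n n'] K.add_closed[of k k']] \<pi>I[of n k] \<pi>I[of n' k']
        by (simp add: add_ac)
    qed
    show "\<pi> (act a m) = act a (\<pi> m)" if m: "m \<in> M" for a m
    proof -
      obtain n k where nk: "n \<in> N" "k \<in> K" "m = n + k" using dec[OF m] by blast
      then have "act a m = act a n + act a k" using act_add_right sub by blast
      then show ?thesis using \<pi>I[OF N.act_closed[of n a] K.act_closed[of k a]] \<pi>I[of n k] nk by simp
    qed
  qed
  then show ?thesis by blast
qed

lemma (in left_module) complement_of_retraction:
  assumes N: "submodule N M act" and \<pi>: "module_retraction M N act \<pi>"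
  shows "\<exists>K. submodule K M act \<and> N \<inter> K = {0} \<and> N + K = M"
proof (intro exI conjI)
  let ?K = "{m \<in> M. \<pi> m = 0}"
  interpret N: left_module N act using N by (simp add: submodule_def)
  have sub: "N \<subseteq> M" using N by (simp add: submodule_def)
  have \<pi>N: "\<pi> m \<in> N" if "m \<in> M" for m using \<pi> that by (simp add: module_retraction_def)
  have \<pi>add: "\<pi> (m + m') = \<pi> m + \<pi> m'" if "m \<in> M" "m' \<in> M" for m m'
    using \<pi> that by (simp add: module_retraction_def)
  have \<pi>act: "\<pi> (act a m) = act a (\<pi> m)" if "m \<in> M" for a m
    using \<pi> that by (simp add: module_retraction_def)
  have \<pi>id: "\<pi> n = n" if "n \<in> N" for n using \<pi> that by (simp add: module_retraction_def)
  have \<pi>minus: "\<pi> (- m) = - \<pi> m" if "m \<in> M" for m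
    using \<pi>add[OF that uminus_closed[OF that]] \<pi>id[OF N.zero_closed]
    by (simp add: eq_neg_iff_add_eq_0 add.commute)
  show "submodule ?K M act"
    by (rule submoduleI)
      (auto simp: zero_closed add_closed uminus_closed act_closed \<pi>id[OF N.zero_closed] \<pi>add \<pi>minus
        \<pi>act act_zero_right)
  show "N \<inter> ?K = {0}" using \<pi>id N.zero_closed zero_closed by force
  show "N + ?K = M"
  proof
    show "N + ?K \<subseteq> M" using sub add_closed by (auto elim!: set_plus_elim)
    show "M \<subseteq> N + ?K"
    proof
      fix m assume m: "m \<in> M"
      have pm: "\<pi> m \<in> M" using \<pi>N[OF m] sub by blast
      have "\<pi> (m + - \<pi> m) = 0"
        using \<pi>add[OF m uminus_closed[OF pm]] \<pi>minus[OF pm] \<pi>id[OF \<pi>N[OF m]] by simp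
      then have "m - \<pi> m \<in> ?K" using diff_closed[OF m pm] by simp
      then have "\<pi> m + (m - \<pi> m) \<in> N + ?K" using \<pi>N[OF m] by blast
      then show "m \<in> N + ?K" by simp
    qed
  qed
qed


section \<open>Modules over a semisimple ring\<close>

text \<open>
  Choose \<open>K\<close> maximal among the submodules that meet \<open>N\<close> trivially. If some \<open>m\<close> were outside \<open>N + K\<close>,
  write \<open>m = b m\<close> and split \<open>b\<close> into components in minimal left ideals: some component lies in a minimal
  left ideal \<open>S\<close> with \<open>S m\<close> not contained in \<open>N + K\<close>. By minimality the elements of \<open>S\<close> that carry \<open>m\<close>
  into \<open>N + K\<close> are only \<open>0\<close>, so \<open>K + S m\<close> still meets \<open>N\<close> trivially, against the choice of \<open>K\<close>.
\<close>

lemma (in left_module) completely_reducible_over_semisimple_ring: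
  assumes unital: "left_s_unital_ring TYPE('a)" and ss: "left_semisimple_ring TYPE('a)"
    and M: "s_unital M act"
  shows "completely_reducible M act"
  unfolding completely_reducible_def
proof (intro allI impI)
  fix N assume N: "submodule N M act"
  interpret N: left_module N act using N by (simp add: submodule_def)
  have UNIV_unital: "s_unital (UNIV :: 'a set) (*)" using unital by (simp add: left_s_unital_ring_def)
  obtain \<S> :: "'a set set" where \<S>_FMod: "\<forall>S\<in>\<S>. FMod_submodule S UNIV (*) \<and> FMod_simple S (*)"
    and ds: "is_internal_direct_sum UNIV \<S> (\<lambda>S. S)"
    using ss unfolding left_semisimple_ring_def FMod_semisimple_def by (elim conjE exE)
  have \<S>: "simple_module S (*)" if "S \<in> \<S>" for S
    using \<S>_FMod that FMod_simple_iff_simple_module[OF unital s_unital_subset[OF UNIV_unital]] by blast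
  obtain K where K: "submodule K M act" "N \<inter> K = {0}"
    and Kmax: "\<And>X. \<lbrakk>submodule X M act; N \<inter> X = {0}; K \<subseteq> X\<rbrakk> \<Longrightarrow> X = K"
  proof (rule maximal_submodule_exists[of "{0}" "\<lambda>K. N \<inter> K = {0}"])
    show "N \<inter> {0} = {0}" using N.zero_closed by blast
    show "N \<inter> \<Union>\<C> = {0}" if "\<C> \<noteq> {}" "\<forall>K\<in>\<C>. N \<inter> K = {0}" for \<C>
      using that by (simp add: Int_Union)
  qed (simp_all add: submodule_zero)
  interpret K: left_module K act using K by (simp add: submodule_def)
  have NK: "submodule (N + K) M act" by (rule submodule_set_plus[OF N K(1)])
  interpret NK: left_module "N + K" act using NK by (simp add: submodule_def)
  have "M \<subseteq> N + K"
  proof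
    fix m assume m: "m \<in> M"
    show "m \<in> N + K"
    proof (rule ccontr)
      assume notin: "m \<notin> N + K"
      obtain b where b: "m = act b m" using M m by (auto simp: s_unital_def)
      have "b \<in> (\<lambda>c. \<Sum>i\<in>{i. c i \<noteq> 0}. c i) ` direct_sum \<S> (\<lambda>S. S)"
        using ds by (simp add: is_internal_direct_sum_def bij_betw_def)
      then obtain c where c: "c \<in> direct_sum \<S> (\<lambda>S. S)" "b = (\<Sum>i\<in>{i. c i \<noteq> 0}. c i)" by blast
      have "m = (\<Sum>i\<in>{i. c i \<noteq> 0}. act (c i) m)" using b c(2) act_sum_left[OF m] by metis
      then obtain S where S: "c S \<noteq> 0" "act (c S) m \<notin> N + K"
        using notin NK.sum_closed[of "{i. c i \<noteq> 0}" "\<lambda>i. act (c i) m"] by auto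
      have SS: "S \<in> \<S>" "c S \<in> S" using c(1) S(1) unfolding direct_sum_def by auto
      interpret S: left_module S "(*)" using \<S>[OF SS(1)] by (simp add: simple_module_def)
      have "submodule {s \<in> S. act s m \<in> N + K} S (*)"
        by (rule S.submoduleI)
          (auto simp: S.zero_closed S.add_closed S.uminus_closed S.act_closed m act_zero_left
            act_add_left act_uminus_left act_mult NK.zero_closed NK.add_closed NK.uminus_closed
            NK.act_closed)
      then have triv: "{s \<in> S. act s m \<in> N + K} = {0}"
        using \<S>[OF SS(1)] S(2) SS(2) unfolding simple_module_def by blast
      let ?Sm = "(\<lambda>s. act s m) ` S"
      have Sm: "submodule ?Sm M act" by (rule submodule_image_act[OF S.left_module_axioms m])
      have "N \<inter> (K + ?Sm) \<subseteq> {0}"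
      proof
        fix n assume n: "n \<in> N \<inter> (K + ?Sm)"
        then obtain k s where ks: "k \<in> K" "s \<in> S" "n = k + act s m" by (auto elim!: set_plus_elim)
        have "act s m = n + - k" using ks by simp
        then have "act s m \<in> N + K" using n K.uminus_closed[OF ks(1)] by (metis IntD1 set_plus_intro)
        then have "s = 0" using triv ks(2) by blast
        then show "n \<in> {0}" using ks n K(2) act_zero_left[OF m] by auto
      qed
      moreover have "0 \<in> K + ?Sm"
        using submodule_set_plus[OF K(1) Sm] left_module.zero_closed by (auto simp: submodule_def)
      ultimately have int: "N \<inter> (K + ?Sm) = {0}" using N.zero_closed by blast
      have "0 \<in> ?Sm" using Sm left_module.zero_closed by (auto simp: submodule_def)
      then have "K \<subseteq> K + ?Sm" using set_plus_intro[of _ K 0 ?Sm] by auto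
      then have "K + ?Sm = K" by (rule Kmax[OF submodule_set_plus[OF K(1) Sm] int])
      moreover have "0 + act (c S) m \<in> K + ?Sm" using K.zero_closed SS(2) by blast
      ultimately have "0 + act (c S) m \<in> N + K" using N.zero_closed K.zero_closed
        by (intro set_plus_intro) auto
      then show False using S(2) by simp
    qed
  qed
  then have "N + K = M" using NK by (auto simp: submodule_def)
  then show "\<exists>K. submodule K M act \<and> N \<inter> K = {0} \<and> N + K = M" using K by blast
qed


section \<open>Averaging along a separable extension\<close>

lemma free_eval_frag_extend:
  "free_eval \<phi> (frag_extend (\<lambda>s. frag_of (g s)) c) = free_eval (\<lambda>s. \<phi> (g s)) c"
  by (rule frag_induction[of c UNIV]) (auto simp: frag_extend_diff free_eval_diff)

lemma free_eval_plus: "free_eval (\<lambda>s. \<phi> s + \<psi> s) c = free_eval \<phi> c + free_eval \<psi> c"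
  by (rule frag_induction[of c UNIV]) (auto simp: free_eval_diff)

lemma (in left_module) act_free_eval_right:
  assumes "\<And>s. \<phi> s \<in> M"
  shows "act a (free_eval \<phi> c) = free_eval (\<lambda>s. act a (\<phi> s)) c"
  by (rule frag_induction[of c UNIV])
    (use assms in \<open>auto simp: free_eval_diff act_zero_right act_diff_right free_eval_closed\<close>)

lemma (in left_module) act_free_eval_left:
  assumes "m \<in> M"
  shows "act (free_eval \<phi> c) m = free_eval (\<lambda>s. act (\<phi> s) m) c"
  by (rule frag_induction[of c UNIV])
    (use assms in \<open>auto simp: free_eval_diff act_zero_left act_diff_left\<close>)

text \<open>
  The retraction \<open>\<pi>\<close> onto the \<open>A\<close>-submodule \<open>N\<close> is linear only over \<open>B\<close>, acting through \<open>f\<close>. That is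
  what makes \<open>x \<otimes> y \<mapsto> x \<pi>(y m)\<close> well defined on \<open>A \<otimes>\<^sub>B A\<close>.
\<close>

locale averaging = left_module M act
  for M :: "'m::ab_group_add set" and act :: "'a::ring \<Rightarrow> 'm \<Rightarrow> 'm" +
  fixes f :: "'b::ring \<Rightarrow> 'a" and N :: "'m set" and \<pi> :: "'m \<Rightarrow> 'm"
  assumes N: "submodule N M act" and \<pi>: "module_retraction M N (\<lambda>b. act (f b)) \<pi>"
begin

definition average :: "'m \<Rightarrow> ('a \<times> 'a \<Rightarrow>\<^sub>0 int) set \<Rightarrow> 'm" where
  "average m = tensor_lift (\<lambda>(x, y). act x (\<pi> (act y m)))"

abbreviation cls :: "('a \<times> 'a \<Rightarrow>\<^sub>0 int) \<Rightarrow> ('a \<times> 'a \<Rightarrow>\<^sub>0 int) set" where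
  "cls \<equiv> tensor_class UNIV (\<lambda>a b. a * f b) UNIV (\<lambda>b a. f b * a)"

lemma N_subset: "N \<subseteq> M"
  using N by (simp add: submodule_def)

lemma retract_in_N: "m \<in> M \<Longrightarrow> \<pi> m \<in> N"
  and retract_add: "\<lbrakk>m \<in> M; m' \<in> M\<rbrakk> \<Longrightarrow> \<pi> (m + m') = \<pi> m + \<pi> m'"
  and retract_act: "m \<in> M \<Longrightarrow> \<pi> (act (f b) m) = act (f b) (\<pi> m)"
  and retract_id: "n \<in> N \<Longrightarrow> \<pi> n = n"
  using \<pi> by (auto simp: module_retraction_def)

lemma retract_closed: "m \<in> M \<Longrightarrow> \<pi> m \<in> M"
  using retract_in_N N_subset by blast

lemma average_class:
  assumes "m \<in> M"
  shows "average m (cls c) = free_eval (\<lambda>(x, y). act x (\<pi> (act y m))) c"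
  unfolding average_def
proof (rule tensor_lift_class, goal_cases)
  case 1
  show ?case by (rule tensor_relations_carrier) auto
qed (use assms in \<open>auto simp: act_closed act_add_left act_add_right act_mult retract_closed
      retract_add retract_act\<close>)

lemma tensor_square_class: "t \<in> carrier (tensor_square f) \<Longrightarrow> \<exists>c. t = cls c"
  by (auto simp: tensor_square_def carrier_tensor_product)

lemma average_in_N:
  assumes "m \<in> M" "t \<in> carrier (tensor_square f)"
  shows "average m t \<in> N"
proof -
  interpret N: left_module N act using N by (simp add: submodule_def)
  show ?thesis using tensor_square_class[OF assms(2)] assms(1)
    by (auto simp: average_class act_closed retract_in_N intro!: N.free_eval_closed N.act_closed)
qed

lemma average_left:
  assumes "m \<in> M" "t \<in> carrier (tensor_square f)"
  shows "average m (tensor_square_left f x t) = act x (average m t)"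
proof -
  obtain c where c: "t = cls c" using tensor_square_class[OF assms(2)] by blast
  have "tensor_square_left f x t = cls (frag_extend (\<lambda>s. frag_of (x * fst s, snd s)) c)"
    unfolding c tensor_square_left_def
    by (subst tensor_map_class) (auto simp: algebra_simps split_beta')
  then show ?thesis
    using assms(1) c
    by (simp add: average_class free_eval_frag_extend act_free_eval_right split_beta' act_mult
        act_closed retract_closed)
qed

lemma average_right:
  assumes "m \<in> M" "t \<in> carrier (tensor_square f)"
  shows "average m (tensor_square_right f t y) = average (act y m) t"
proof -
  obtain c where c: "t = cls c" using tensor_square_class[OF assms(2)] by blast
  have "tensor_square_right f t y = cls (frag_extend (\<lambda>s. frag_of (fst s, snd s * y)) c)"
    unfolding c tensor_square_right_def
    by (subst tensor_map_class) (auto simp: algebra_simps split_beta')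
  then show ?thesis
    using assms(1) c
    by (simp add: average_class free_eval_frag_extend split_beta' act_mult act_closed)
qed

lemma average_add:
  assumes "m \<in> M" "m' \<in> M" "t \<in> carrier (tensor_square f)"
  shows "average (m + m') t = average m t + average m' t"
  using tensor_square_class[OF assms(3)] assms(1,2)
  by (auto simp: average_class add_closed act_add_right act_closed retract_add retract_closed
      split_beta' free_eval_plus)

text \<open>
  On \<open>N\<close> the retraction disappears from \<open>x \<pi>(y n) = x y n\<close>, leaving the multiplication map.
\<close>

lemma average_on_N:
  assumes "n \<in> N" "t \<in> carrier (tensor_square f)"
  shows "average n t = act (tensor_lift (\<lambda>(a, a'). a * a') t) n"
proof -
  interpret N: left_module N act using N by (simp add: submodule_def)
  obtain c where c: "t = cls c" using tensor_square_class[OF assms(2)] by blast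
  have "tensor_lift (\<lambda>(a, a'). a * a') t = free_eval (\<lambda>(a, a'). a * a') c"
    unfolding c
  proof (rule tensor_lift_class, goal_cases)
    case 1
    show ?case by (rule tensor_relations_carrier) auto
  qed (auto simp: algebra_simps)
  then show ?thesis
    using assms(1) N_subset c
    by (auto simp: average_class act_free_eval_left act_mult N.act_closed retract_id split_beta' subset_iff)
qed

text \<open>
  With \<open>\<phi>\<^sub>m\<close> for the average of \<open>m\<close>, the bimodule map \<open>\<sigma>\<close> satisfies \<open>\<phi>\<^sub>m(\<sigma>(x a)) = x \<phi>\<^sub>m(\<sigma>(a))\<close> and
  \<open>\<phi>\<^sub>m(\<sigma>(a y)) = \<phi>\<^bsub>y m\<^esub>(\<sigma>(a))\<close>. The second
  identity makes \<open>\<phi>\<^sub>m(\<sigma>(e))\<close> independent of the \<open>e\<close> with \<open>e m = m\<close>; both together give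
  \<open>\<phi>\<^bsub>a m\<^esub>(\<sigma>(e)) = \<phi>\<^sub>m(\<sigma>(e a)) = \<phi>\<^sub>m(\<sigma>(a u)) = a \<phi>\<^sub>m(\<sigma>(u))\<close> for \<open>e a = a\<close> and \<open>u m = m\<close>, which is
  \<open>A\<close>-linearity.
\<close>

lemma retraction_of_separable:
  assumes unital: "left_s_unital_ring TYPE('a)" and M: "s_unital M act" and sep: "separable f"
  shows "\<exists>\<rho>. module_retraction M N act \<rho>"
proof -
  obtain \<sigma> where \<sigma>: "\<sigma> \<in> hom (additive_group UNIV) (tensor_square f)"
    and left: "\<And>x a. \<sigma> (x * a) = tensor_square_left f x (\<sigma> a)"
    and right: "\<And>a y. \<sigma> (a * y) = tensor_square_right f (\<sigma> a) y"
    and sect: "\<And>a. tensor_lift (\<lambda>(a, a'). a * a') (\<sigma> a) = a"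
    using sep unfolding separable_def by blast
  have carr: "\<sigma> a \<in> carrier (tensor_square f)" for a using \<sigma> by (auto simp: hom_def)
  have L: "average m (\<sigma> (x * a)) = act x (average m (\<sigma> a))" if "m \<in> M" for m x a
    using that by (simp add: left average_left carr)
  have R: "average m (\<sigma> (a * y)) = average (act y m) (\<sigma> a)" if "m \<in> M" for m a y
    using that by (simp add: right average_right carr)
  have indep: "average m (\<sigma> e) = average m (\<sigma> e')"
    if m: "m \<in> M" and e: "act e m = m" "act e' m = m" for m e e'
  proof -
    obtain d where d: "d * e = e" "d * e' = e'" using common_left_unit[OF unital, of "{e, e'}"] by auto
    have "average m (\<sigma> e) = average m (\<sigma> d)" using R[OF m, of d e] d(1) e(1) by simp
    moreover have "average m (\<sigma> e') = average m (\<sigma> d)" using R[OF m, of d e'] d(2) e(2) by simp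
    ultimately show ?thesis by simp
  qed
  define \<rho> where "\<rho> m = average m (\<sigma> (SOME e. act e m = m))" for m
  have \<rho>: "\<rho> m = average m (\<sigma> e)" if m: "m \<in> M" "act e m = m" for m e
    unfolding \<rho>_def using indep[OF m(1) someI[of "\<lambda>e. act e m = m", OF m(2)] m(2)] .
  have unit: "\<exists>e. act e m = m" if "m \<in> M" for m using M that by (metis s_unital_def)
  have "module_retraction M N act \<rho>"
    unfolding module_retraction_def
  proof (intro conjI ballI allI)
    show "\<rho> m \<in> N" if "m \<in> M" for m
      using unit[OF that] \<rho>[OF that] average_in_N[OF that carr] by auto
    show "\<rho> n = n" if n: "n \<in> N" for n
    proof -
      have "n \<in> M" using n N_subset by blast
      then obtain e where "act e n = n" using unit by blast
      then show ?thesis using \<rho>[OF \<open>n \<in> M\<close>] average_on_N[OF n carr] sect by simp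
    qed
    show "\<rho> (m + m') = \<rho> m + \<rho> m'" if m: "m \<in> M" "m' \<in> M" for m m'
    proof -
      obtain e where e: "act e m = m" "act e m' = m'"
        using common_local_unit[OF M, of "{m, m'}"] m by auto
      then have "act e (m + m') = m + m'" using act_add_right[OF m] by simp
      then show ?thesis using \<rho> m e average_add[OF m carr] by (simp add: add_closed)
    qed
    show "\<rho> (act a m) = act a (\<rho> m)" if m: "m \<in> M" for a m
    proof -
      obtain e where e: "e * a = a" using common_left_unit[OF unital, of "{a}"] by auto
      obtain u where u: "act u m = m" using unit[OF m] by blast
      have "\<rho> (act a m) = average (act a m) (\<sigma> e)"
        using act_mult[OF m, of e a] e by (intro \<rho>) (simp_all add: act_closed m)
      also have "\<dots> = average m (\<sigma> a)" using R[OF m, of e a] e by simp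
      also have "\<dots> = average m (\<sigma> (a * u))" using R[OF m, of a u] u by simp
      also have "\<dots> = act a (\<rho> m)" using L[OF m] \<rho>[OF m u] by simp
      finally show ?thesis .
    qed
  qed
  then show ?thesis by blast
qed

end

lemma (in left_module) left_module_restrict_scalars:
  assumes "ring_homomorphism f"
  shows "left_module M (\<lambda>b. act (f b))"
  using assms zero_closed add_closed uminus_closed act_closed act_add_left act_add_right act_mult
  by unfold_locales (auto simp: ring_homomorphism_def)

text \<open>
  If \<open>m = e m\<close> and \<open>e = f(b) e\<close>, then \<open>m = f(b) m\<close>.
\<close>

lemma (in left_module) s_unital_restrict_scalars:
  assumes "left_s_unital_hom f" "s_unital M act"
  shows "s_unital M (\<lambda>b. act (f b))"
  unfolding s_unital_def
proof
  fix m assume m: "m \<in> M"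
  then obtain e where e: "m = act e m" using assms(2) by (auto simp: s_unital_def)
  obtain b where "e = f b * e" using assms(1) by (auto simp: left_s_unital_hom_def s_unital_def)
  then have "m = act (f b) m" using act_mult[OF m, of "f b" e] e by metis
  then show "\<exists>b. m = act (f b) m" by blast
qed

lemma (in left_module) completely_reducible_of_separable:
  assumes "left_s_unital_ring TYPE('a)" "s_unital M act" "ring_homomorphism f" "separable f"
    and cr: "completely_reducible M (\<lambda>b. act (f b))"
  shows "completely_reducible M act"
  unfolding completely_reducible_def
proof (intro allI impI)
  fix N assume N: "submodule N M act"
  interpret B: left_module M "\<lambda>b. act (f b)" by (rule left_module_restrict_scalars[OF assms(3)])
  have "submodule N M (\<lambda>b. act (f b))"
    using N left_module.left_module_restrict_scalars[OF _ assms(3), of N act] by (simp add: submodule_def)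
  then obtain \<pi> where "module_retraction M N (\<lambda>b. act (f b)) \<pi>"
    using cr B.retraction_of_complement unfolding completely_reducible_def by meson
  then interpret averaging M act f N \<pi> using N by unfold_locales
  show "\<exists>K. submodule K M act \<and> N \<inter> K = {0} \<and> N + K = M"
    using retraction_of_separable[OF assms(1,2,4)] complement_of_retraction[OF N] by blast
qed


section \<open>Decomposition into simple submodules\<close>

text \<open>
  Fix \<open>m \<noteq> 0\<close> in \<open>M\<close>. Since \<open>M\<close> is s-unital, \<open>m\<close> lies in \<open>A m\<close>, so \<open>A m\<close> is the smallest submodule containing \<open>m\<close>. Let
  \<open>K \<subseteq> A m\<close> be maximal among the submodules without \<open>m\<close>, and \<open>D\<close> a complement of \<open>K\<close> in \<open>A m\<close>. For a
  nonzero submodule \<open>E\<close> of \<open>D\<close>, maximality puts \<open>m\<close> into \<open>K + E\<close>, so \<open>K + E = A m = K + D\<close> and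
  \<open>E = D\<close>. Hence \<open>D\<close> is simple.
\<close>

lemma (in left_module) simple_submodule_exists:
  assumes M: "s_unital M act" and cr: "completely_reducible M act" and nz: "M \<noteq> {0}"
  shows "\<exists>S. submodule S M act \<and> simple_module S act"
proof -
  obtain m where m: "m \<in> M" "m \<noteq> 0" using nz zero_closed by blast
  let ?C = "range (\<lambda>a. act a m)"
  have C: "submodule ?C M act" by (rule submodule_image_act[OF left_module_ring m(1)])
  interpret C: left_module ?C act using C by (simp add: submodule_def)
  have mC: "m \<in> ?C" using M m(1) by (auto simp: s_unital_def)
  have gen: "L = ?C" if L: "submodule L ?C act" "m \<in> L" for L
    using L left_module.act_closed[of L act m] by (auto simp: submodule_def)
  obtain K where K: "submodule K ?C act" "m \<notin> K"
    and Kmax: "\<And>X. \<lbrakk>submodule X ?C act; m \<notin> X; K \<subseteq> X\<rbrakk> \<Longrightarrow> X = K"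
    by (rule C.maximal_submodule_exists[of "{0}" "\<lambda>K. m \<notin> K"])
      (use C.submodule_zero m(2) in \<open>simp_all\<close>)
  obtain D where D: "submodule D ?C act" "K \<inter> D = {0}" "K + D = ?C"
    using completely_reducible_submodule[OF cr C, unfolded completely_reducible_def, rule_format, OF K(1)]
    by (elim exE conjE)
  interpret K: left_module K act using K by (simp add: submodule_def)
  interpret D: left_module D act using D by (simp add: submodule_def)
  have "simple_module D act"
    unfolding simple_module_def
  proof (intro conjI allI impI)
    show "left_module D act" by (rule D.left_module_axioms)
    show "D \<noteq> {0}" using D(3) mC K(2) by (auto elim!: set_plus_elim)
    fix E assume E: "submodule E D act"
    interpret E: left_module E act using E by (simp add: submodule_def)
    have ED: "E \<subseteq> D" using E by (simp add: submodule_def)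
    have KE: "submodule (K + E) ?C act"
      by (rule C.submodule_set_plus[OF K(1) submodule_trans[OF E D(1)]])
    have incl: "K \<subseteq> K + E" "E \<subseteq> K + E"
      using set_plus_intro[OF _ E.zero_closed, of _ K] set_plus_intro[OF K.zero_closed, of _ E] by auto
    show "E = {0} \<or> E = D"
    proof (cases "m \<in> K + E")
      case True
      have "D \<subseteq> E"
      proof
        fix d assume d: "d \<in> D"
        then have "d \<in> K + E" using gen[OF KE True] D(1) by (auto simp: submodule_def)
        then obtain k e where ke: "k \<in> K" "e \<in> E" "d = k + e" by (auto elim!: set_plus_elim)
        then have "k \<in> D" using D.diff_closed[OF d, of e] ED by auto
        then have "k \<in> K \<inter> D" using ke(1) by blast
        then show "d \<in> E" unfolding D(2) using ke by simp
      qed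
      then show ?thesis using ED by blast
    next
      case False
      then have "E \<subseteq> K" using Kmax[OF KE] incl by blast
      then show ?thesis using D(2) ED E.zero_closed by blast
    qed
  qed
  then show ?thesis using submodule_trans[OF D(1) C] by blast
qed

definition independent_family :: "'m::ab_group_add set set \<Rightarrow> bool" where
  "independent_family \<S> \<longleftrightarrow> (\<forall>c\<in>direct_sum \<S> (\<lambda>S. S). Sum_any c = 0 \<longrightarrow> c = (\<lambda>_. 0))"

lemma independent_family_Union_chain:
  assumes "\<C> \<noteq> {}" "subset.chain {\<S>. independent_family \<S>} \<C>"
  shows "independent_family (\<Union>\<C>)"
  unfolding independent_family_def
proof (intro ballI impI)
  fix c assume c: "c \<in> direct_sum (\<Union>\<C>) (\<lambda>S. S)" and z: "Sum_any c = 0"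
  have "finite {i. c i \<noteq> 0}" "{i. c i \<noteq> 0} \<subseteq> \<Union>\<C>" using c unfolding direct_sum_def by auto
  then obtain \<S> where S: "\<S> \<in> \<C>" "{i. c i \<noteq> 0} \<subseteq> \<S>"
    using finite_subset_Union_chain[OF _ _ assms] by blast
  then have "c \<in> direct_sum \<S> (\<lambda>S. S)" using c unfolding direct_sum_def by auto
  then show "c = (\<lambda>_. 0)" using assms(2) S(1) z by (auto simp: subset_chain_def independent_family_def)
qed

text \<open>
  Take a maximal independent family of simple submodules. A nonzero complement of its sum would contain
  a further simple submodule, and adding that one would keep the family independent.
\<close>

lemma (in left_module) direct_sum_of_simples:
  assumes M: "s_unital M act" and cr: "completely_reducible M act"
  shows "\<exists>\<S>. (\<forall>S\<in>\<S>. submodule S M act \<and> simple_module S act) \<and>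
              is_internal_direct_sum M \<S> (\<lambda>S. S)"
proof -
  let ?P = "\<lambda>\<S>. (\<forall>S\<in>\<S>. submodule S M act \<and> simple_module S act) \<and> independent_family \<S>"
  have "\<exists>\<S>\<in>{\<S>. ?P \<S>}. \<forall>X\<in>{\<S>. ?P \<S>}. \<S> \<subseteq> X \<longrightarrow> X = \<S>"
  proof (rule subset_Zorn_nonempty)
    have "?P {}" by (auto simp: independent_family_def direct_sum_def)
    then show "{\<S>. ?P \<S>} \<noteq> {}" by blast
    fix \<C> assume "\<C> \<noteq> {}" "subset.chain {\<S>. ?P \<S>} \<C>"
    then show "\<Union>\<C> \<in> {\<S>. ?P \<S>}"
      using independent_family_Union_chain[of \<C>] by (auto simp: subset_chain_def)
  qed
  then obtain \<S> where P: "?P \<S>" and max': "\<forall>X\<in>{\<S>. ?P \<S>}. \<S> \<subseteq> X \<longrightarrow> X = \<S>"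
    by (elim bexE CollectE)
  have max: "X = \<S>" if "?P X" "\<S> \<subseteq> X" for X
    using max'[rule_format, OF CollectI, OF that] .
  have \<S>: "submodule S M act" "simple_module S act" if "S \<in> \<S>" for S using P that by blast+
  have ind: "independent_family \<S>" using P by blast
  have \<S>mod: "left_module S act" "S \<subseteq> M" if "S \<in> \<S>" for S
    using \<S>(1)[OF that] by (auto simp: submodule_def)
  let ?D = "direct_sum \<S> (\<lambda>S. S)"
  have fin: "finite {i. c i \<noteq> 0}" if "c \<in> ?D" for c using that by (simp add: direct_sum_def)
  have in_M: "c i \<in> M" if "c \<in> ?D" for c i
    using that \<S>mod(2) zero_closed unfolding direct_sum_def by (cases "i \<in> \<S>") auto
  have zero: "(\<lambda>_. 0) \<in> ?D"
    using left_module.zero_closed[OF \<S>mod(1)] by (auto simp: direct_sum_def)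
  have add: "(\<lambda>i. c i + d i) \<in> ?D" if "c \<in> ?D" "d \<in> ?D" for c d
  proof -
    have "finite {i. c i + d i \<noteq> 0}"
      by (rule finite_subset[OF _ finite_UnI[OF fin[OF that(1)] fin[OF that(2)]]]) auto
    then show ?thesis using that left_module.add_closed[OF \<S>mod(1)] by (auto simp: direct_sum_def)
  qed
  have minus: "(\<lambda>i. - c i) \<in> ?D" if "c \<in> ?D" for c
    using that left_module.uminus_closed[OF \<S>mod(1)] by (auto simp: direct_sum_def)
  have act: "(\<lambda>i. act a (c i)) \<in> ?D" if "c \<in> ?D" for a c
  proof -
    have "finite {i. act a (c i) \<noteq> 0}"
      by (rule finite_subset[OF _ fin[OF that]]) (auto simp: act_zero_right)
    then show ?thesis
      using that left_module.act_closed[OF \<S>mod(1)] by (auto simp: direct_sum_def act_zero_right)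
  qed
  have sum_add: "Sum_any (\<lambda>i. c i + d i) = Sum_any c + Sum_any d" if "c \<in> ?D" "d \<in> ?D" for c d
    using Sum_any.distrib[OF fin fin] that by blast
  have sum_minus: "Sum_any (\<lambda>i. - c i) = - Sum_any c" if "c \<in> ?D" for c
    using sum_add[OF that minus[OF that]] by (simp add: eq_neg_iff_add_eq_0 add.commute)
  have sum_act: "Sum_any (\<lambda>i. act a (c i)) = act a (Sum_any c)" if c: "c \<in> ?D" for a c
  proof -
    have "Sum_any (\<lambda>i. act a (c i)) = (\<Sum>i\<in>{i. c i \<noteq> 0}. act a (c i))"
      by (rule Sum_any.expand_superset[OF fin[OF c]]) (auto simp: act_zero_right)
    then show ?thesis using act_sum_right[of _ c a] in_M[OF c] by (simp add: Sum_any.expand_set)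
  qed
  have T: "submodule (Sum_any ` ?D) M act"
  proof (rule submoduleI)
    show "Sum_any ` ?D \<subseteq> M" using in_M by (auto simp: Sum_any.expand_set intro!: sum_closed)
    show "0 \<in> Sum_any ` ?D" using zero by (metis Sum_any.neutral image_eqI)
  next
    fix x y assume "x \<in> Sum_any ` ?D" "y \<in> Sum_any ` ?D"
    then obtain c d where cd: "c \<in> ?D" "d \<in> ?D" and xy: "x = Sum_any c" "y = Sum_any d" by blast
    show "x + y \<in> Sum_any ` ?D"
      unfolding xy sum_add[OF cd, symmetric] by (rule imageI[OF add[OF cd]])
  next
    fix x assume "x \<in> Sum_any ` ?D"
    then obtain c where c: "c \<in> ?D" and x: "x = Sum_any c" by blast
    show "- x \<in> Sum_any ` ?D"
      unfolding x sum_minus[OF c, symmetric] by (rule imageI[OF minus[OF c]])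
    show "act a x \<in> Sum_any ` ?D" for a
      unfolding x sum_act[OF c, symmetric] by (rule imageI[OF act[OF c]])
  qed
  obtain K where K: "submodule K M act" "Sum_any ` ?D \<inter> K = {0}" "Sum_any ` ?D + K = M"
    using cr T unfolding completely_reducible_def by blast
  have "K = {0}"
  proof (rule ccontr)
    assume nz: "K \<noteq> {0}"
    interpret K: left_module K act using K(1) by (simp add: submodule_def)
    obtain S where S: "submodule S K act" "simple_module S act"
      using K.simple_submodule_exists[OF s_unital_subset[OF M] completely_reducible_submodule[OF cr K(1)] nz]
        K(1) by (auto simp: submodule_def)
    interpret S: left_module S act using S(1) by (simp add: submodule_def)
    have SK: "S \<subseteq> K" using S(1) by (simp add: submodule_def)
    have "independent_family (insert S \<S>)"
      unfolding independent_family_def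
    proof (intro ballI impI)
      fix c assume c: "c \<in> direct_sum (insert S \<S>) (\<lambda>S. S)" and z: "Sum_any c = 0"
      let ?d = "c(S := 0)"
      have finc: "finite {i. c i \<noteq> 0}" using c by (simp add: direct_sum_def)
      have find: "finite {i. ?d i \<noteq> 0}" by (rule finite_subset[OF _ finc]) auto
      have d: "?d \<in> ?D" using c find left_module.zero_closed[OF \<S>mod(1)]
        by (auto simp: direct_sum_def)
      have fine: "finite {i. (if i = S then c S else 0) \<noteq> 0}"
        by (rule finite_subset[of _ "{S}"]) auto
      have "Sum_any c = Sum_any (\<lambda>i. ?d i + (if i = S then c S else 0))"
        by (rule Sum_any.cong) simp
      also have "\<dots> = Sum_any ?d + Sum_any (\<lambda>i. if i = S then c S else 0)"
        by (rule Sum_any.distrib[OF find fine])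
      also have "Sum_any (\<lambda>i. if i = S then c S else 0) = c S" by simp
      finally have cS: "c S = - Sum_any ?d" using z by (simp add: eq_neg_iff_add_eq_0 add.commute)
      have "- Sum_any ?d \<in> Sum_any ` ?D"
        using T d left_module.uminus_closed by (fastforce simp: submodule_def)
      moreover have "c S \<in> K" using c SK by (auto simp: direct_sum_def)
      ultimately have "c S \<in> Sum_any ` ?D \<inter> K" unfolding cS by (rule IntI)
      then have "c S = 0" unfolding K(2) by simp
      then have "?d = c" by auto
      then show "c = (\<lambda>_. 0)" using ind d z by (auto simp: independent_family_def)
    qed
    then have "?P (insert S \<S>)" using \<S> S submodule_trans[OF S(1) K(1)] by blast
    \<comment> \<open>Maximality only says that \<open>S\<close> was already in the family; then it lies in both summands.\<close>
    then have "S \<in> \<S>" using max[of "insert S \<S>"] by blast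
    have "S \<subseteq> Sum_any ` ?D"
    proof
      fix s assume s: "s \<in> S"
      have "finite {i. (if i = S then s else 0) \<noteq> 0}" by (rule finite_subset[of _ "{S}"]) auto
      then have "(\<lambda>i. if i = S then s else 0) \<in> ?D"
        using \<open>S \<in> \<S>\<close> s left_module.zero_closed[OF \<S>mod(1)] by (auto simp: direct_sum_def)
      moreover have "Sum_any (\<lambda>i. if i = S then s else 0) = s" by simp
      ultimately show "s \<in> Sum_any ` ?D" by (metis (no_types, lifting) image_eqI)
    qed
    then have "S = {0}" using SK K(2) S.zero_closed by blast
    then show False using S(2) by (simp add: simple_module_def)
  qed
  then have surj: "Sum_any ` ?D = M" using K(3) by simp
  have "inj_on Sum_any ?D"
  proof (rule inj_onI)
    fix c d assume cd: "c \<in> ?D" "d \<in> ?D" "Sum_any c = Sum_any d"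
    have "Sum_any (\<lambda>i. c i + - d i) = 0"
      using sum_add[OF cd(1) minus[OF cd(2)]] sum_minus[OF cd(2)] cd(3) by simp
    then have "(\<lambda>i. c i + - d i) = (\<lambda>_. 0)"
      using ind add[OF cd(1) minus[OF cd(2)]] unfolding independent_family_def by blast
    then show "c = d" by (simp add: fun_eq_iff)
  qed
  then have "bij_betw Sum_any ?D M" using surj by (simp add: bij_betw_def)
  then have "is_internal_direct_sum M \<S> (\<lambda>S. S)"
    unfolding is_internal_direct_sum_def Sum_any.expand_set[abs_def] .
  then show ?thesis using \<S> by blast
qed

theorem FMod_semisimple_of_separable:
  fixes f :: "'b::ring \<Rightarrow> 'a::ring" and act :: "'a \<Rightarrow> 'm::ab_group_add \<Rightarrow> 'm"
  assumes A: "left_s_unital_ring TYPE('a)" and B: "left_s_unital_ring TYPE('b)"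
    and "left_semisimple_ring TYPE('b)" "ring_homomorphism f" "left_s_unital_hom f" "separable f"
    and M: "FMod M act"
  shows "FMod_semisimple M act"
proof -
  have unital: "s_unital M act" using M FMod_iff_s_unital[OF A] by blast
  interpret left_module M act using M by (simp add: FMod_def)
  interpret B: left_module M "\<lambda>b. act (f b)" by (rule left_module_restrict_scalars) fact
  have "completely_reducible M (\<lambda>b. act (f b))"
    using assms s_unital_restrict_scalars[OF _ unital]
    by (intro B.completely_reducible_over_semisimple_ring)
  then have "completely_reducible M act"
    by (rule completely_reducible_of_separable[OF A unital assms(4,6)])
  then obtain \<S> where "\<forall>S\<in>\<S>. submodule S M act \<and> simple_module S act"
    and ds: "is_internal_direct_sum M \<S> (\<lambda>S. S)"
    using direct_sum_of_simples[OF unital] by blast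
  moreover have "FMod_submodule S M act \<and> FMod_simple S act"
    if "submodule S M act" "simple_module S act" for S
    using that FMod_submodule_iff_submodule[OF A unital]
      FMod_simple_iff_simple_module[OF A s_unital_subset[OF unital]]
    by (auto simp: submodule_def)
  ultimately show ?thesis unfolding FMod_semisimple_def using M by blast
qed

theorem theorem4:
  fixes f :: "'b::ring \<Rightarrow> 'a::ring"
  assumes "left_s_unital_ring TYPE('a)"
    and "left_s_unital_ring TYPE('b)"
    and "left_semisimple_ring TYPE('b)"
    and "ring_homomorphism f"
    and "left_s_unital_hom f"
    and "separable f"
  shows "left_semisimple_ring TYPE('a)"
proof -
  have "FMod (UNIV :: 'a set) (*)"
    using assms(1) left_module_ring by (simp add: FMod_iff_s_unital left_s_unital_ring_def)
  then show ?thesis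
    unfolding left_semisimple_ring_def by (rule FMod_semisimple_of_separable[OF assms])
qed

end
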